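(* Fix $k\in\{4,8,12\}$, and let $f=f_k$. Let $\bm{w}$ be the infinite word over $\Sigma_k=\{1,2,\dots,k\}$ with prefix $12\cdots(k-1)$ and encoding $t(\bm{w})=g(f^\omega(1))$. Then $\bm{w}$ is undirected $(k-1)/(k-2)^+$-free.
   Context: For a word $x=x_1\cdots x_n$, $x^R=x_n\cdots x_1$ denotes its reversal. For rational $1<r\leq 2$, an undirected $r$-power is a word of the form $xyx'$ with $x$ nonempty, $x'\in\{x,x^R\}$, and $|xyx'|/|xy|=r$. A word is undirected $\alpha^+$-free if none of its factors is an undirected $r$-power with $r>\alpha$. The morphisms $f_4,f_8,f_{12}:\{1,2\}^*\to\{1,2\}^*$ are defined by $f_4(1)=121$, $f_4(2)=122$; $f_8(1)=121212112122121$, $f_8(2)=211212122122112$; $f_{12}(1)=121212121211212122121$, $f_{12}(2)=212122112121121212212$. The morphism $g:\{1,2\}^*\to\{1,2,3\}^*$ is defined by $g(1)=31$, $g(2)=312$. Ternary encoding: let $w\in\Sigma_k^*$ contain at least $k-1$ distinct letters, with every length-$(k-2)$ factor having $k-2$ distinct letters and every length-$k$ factor having at least $k-1$ distinct letters. Let $u$ be the shortest prefix of $w$ containing $k-1$ distinct letters, and write $w=uv$ with $v=v_1\cdots v_n$. Let $p_0=u$ and $p_i=uv_1\cdots v_i$. Each $p_i$ determines a permutation $r_i$ of $\Sigma_k$ ranking the letters by the index of their final appearance in $p_i$: $r_i[3]\cdots r_i[k]$ is the length-$(k-2)$ suffix of $p_i$; of the two remaining letters, $r_i[2]$ is the one appearing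 last in $p_i$, and $r_i[1]$ is the other (it may not appear in $p_i$ at all). Each $v_i$ lies in $\{r_{i-1}[1],r_{i-1}[2],r_{i-1}[3]\}$, and the encoding is $t(w)=t_1\cdots t_n$ with $t_i=j$ when $v_i=r_{i-1}[j]$, $j\in\{1,2,3\}$. The word $w$ is recoverable from $u$ and $t(w)$; this is how $\bm{w}$ is defined from the prefix $12\cdots(k-1)$ and the encoding $g(f^\omega(1))$ (extended to infinite words in the obvious way). *)

theory Defs
  imports Complex_Main "HOL-Library.Stream" "HOL-Library.Multiset"
begin

text \<open>
  Finite words are lists and infinite words are streams. Letters are natural numbers, so that
  the alphabet with \<open>k\<close> letters is \<open>{1..k}\<close>.
\<close>

definition undirected_power :: "rat \<Rightarrow> 'a list \<Rightarrow> bool" where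
  "undirected_power r z \<longleftrightarrow> 1 < r \<and> r \<le> 2 \<and>
     (\<exists>x y x'. z = x @ y @ x' \<and> x \<noteq> [] \<and> x' \<in> {x, rev x} \<and>
        of_nat (length (x @ y @ x')) / of_nat (length (x @ y)) = r)"

definition factors :: "'a stream \<Rightarrow> 'a list set" where
  "factors w = {stake n (sdrop i w) | i n. True}"

definition undirected_plus_free :: "rat \<Rightarrow> 'a stream \<Rightarrow> bool" where
  "undirected_plus_free \<alpha> w \<longleftrightarrow> \<not> (\<exists>z \<in> factors w. \<exists>r > \<alpha>. undirected_power r z)"

text \<open>
  A morphism is given by its images of letters, of which only those of \<open>1\<close> and \<open>2\<close> matter.
\<close>

definition f4 :: "nat \<Rightarrow> nat list" where
  "f4 a = (if a = 1 then [1,2,1] else if a = 2 then [1,2,2] else [])"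

definition f8 :: "nat \<Rightarrow> nat list" where
  "f8 a = (if a = 1 then [1,2,1,2,1,2,1,1,2,1,2,2,1,2,1]
           else if a = 2 then [2,1,1,2,1,2,1,2,2,1,2,2,1,1,2] else [])"

definition f12 :: "nat \<Rightarrow> nat list" where
  "f12 a = (if a = 1 then [1,2,1,2,1,2,1,2,1,2,1,1,2,1,2,1,2,2,1,2,1]
            else if a = 2 then [2,1,2,1,2,2,1,1,2,1,2,1,1,2,1,2,1,2,2,1,2] else [])"

definition f_of :: "nat \<Rightarrow> nat \<Rightarrow> nat list" where
  "f_of k = (if k = 4 then f4 else if k = 8 then f8 else f12)"

definition g :: "nat \<Rightarrow> nat list" where
  "g a = (if a = 1 then [3,1] else if a = 2 then [3,1,2] else [])"

definition morph :: "('a \<Rightarrow> 'b list) \<Rightarrow> 'a list \<Rightarrow> 'b list" where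
  "morph h u = concat (map h u)"

definition smorph :: "('a \<Rightarrow> 'b list) \<Rightarrow> 'a stream \<Rightarrow> 'b stream" where
  "smorph h x = flat (smap h x)"

text \<open>The infinite word \<open>h\<^sup>\<omega>(a)\<close> having every \<open>h\<^sup>n(a)\<close> as a prefix.\<close>

definition omega_word :: "('a \<Rightarrow> 'a list) \<Rightarrow> 'a \<Rightarrow> 'a stream" where
  "omega_word h a =
     (THE x. \<forall>n. stake (length ((morph h ^^ n) [a])) x = (morph h ^^ n) [a])"

definition encodable :: "nat \<Rightarrow> nat stream \<Rightarrow> bool" where
  "encodable k w \<longleftrightarrow> sset w \<subseteq> {1..k} \<and> card (sset w) \<ge> k - 1 \<and>
     (\<forall>z \<in> factors w. length z = k - 2 \<longrightarrow> card (set z) = k - 2) \<and>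
     (\<forall>z \<in> factors w. length z = k \<longrightarrow> card (set z) \<ge> k - 1)"

text \<open>The (1-based) index of the final appearance of a letter, \<open>0\<close> if there is none.\<close>

definition last_pos :: "'a list \<Rightarrow> 'a \<Rightarrow> nat" where
  "last_pos p a = Max (insert 0 {Suc i | i. i < length p \<and> p ! i = a})"

text \<open>
  The ranking \<open>r[1] \<dots> r[k]\<close> determined by a prefix \<open>p\<close>. If \<open>p\<close> contains at least \<open>k - 1\<close> of
  the \<open>k\<close> letters, there are no ties; a letter missing in \<open>p\<close> comes first.
\<close>

definition ranking :: "nat \<Rightarrow> nat list \<Rightarrow> nat list" where
  "ranking k p = sort_key (last_pos p) [1..<Suc k]"

text \<open>The length of the shortest prefix \<open>u\<close> containing \<open>k - 1\<close> distinct letters.\<close>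

definition init_len :: "nat \<Rightarrow> nat stream \<Rightarrow> nat" where
  "init_len k w = (LEAST m. card (set (stake m w)) = k - 1)"

text \<open>
  With \<open>w = u v\<close> and counting positions of \<open>v\<close> and of \<open>t(w)\<close> from \<open>0\<close>, the letter at
  position \<open>i\<close> of \<open>t(w)\<close> is obtained from the ranking of \<open>u v\<^sub>0 \<dots> v\<^sub>i\<^sub>-\<^sub>1\<close>, whose entries
  are counted from \<open>1\<close>.
\<close>

definition encoding :: "nat \<Rightarrow> nat stream \<Rightarrow> nat stream" where
  "encoding k w = smap (\<lambda>i. THE j. j \<in> {1,2,3} \<and>
     w !! (init_len k w + i) = ranking k (stake (init_len k w + i) w) ! (j - 1)) nats"

subsection \<open>Existence of the encoded words\<close>

lemma stream_eqI: "(\<And>i. s !! i = t !! i) \<Longrightarrow> s = t"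
  using smap_alt[of id s t] by (simp add: stream.map_id)

lemma omega_word_exists:
  fixes h :: "'a \<Rightarrow> 'a list"
  assumes h: "h a = a # u" "u \<noteq> []" and ne: "\<And>b. b \<in> A \<Longrightarrow> h b \<noteq> [] \<and> set (h b) \<subseteq> A"
    and a: "a \<in> A"
  shows "\<forall>n. stake (length ((morph h ^^ n) [a])) (omega_word h a) = (morph h ^^ n) [a]"
    and "sset (omega_word h a) \<subseteq> A"
proof -
  define F where "F n = (morph h ^^ n) [a]" for n
  have mapp: "morph h (xs @ ys) = morph h xs @ morph h ys" for xs ys
    by (simp add: morph_def)
  have FS: "F (Suc n) = morph h (F n)" for n by (simp add: F_def)
  have setA: "set (F n) \<subseteq> A" for n
  proof (induction n)
    case 0 show ?case using a by (simp add: F_def)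
  next
    case (Suc n) then show ?case using ne by (fastforce simp: FS morph_def)
  qed
  have ex: "\<exists>v. F (Suc n) = F n @ v \<and> v \<noteq> [] \<and> set v \<subseteq> A" for n
  proof (induction n)
    case 0 show ?case using h ne[OF a] by (simp add: F_def morph_def)
  next
    case (Suc n)
    then obtain v where v: "F (Suc n) = F n @ v" "v \<noteq> []" "set v \<subseteq> A" by blast
    have "F (Suc (Suc n)) = F (Suc n) @ morph h v"
      using v(1) FS mapp by metis
    moreover have "morph h v \<noteq> []"
      using v ne by (cases v) (auto simp: morph_def)
    moreover have "set (morph h v) \<subseteq> A"
      using v ne by (fastforce simp: morph_def)
    ultimately show ?case by blast
  qed
  have len: "n < length (F n)" for n
  proof (induction n)
    case 0 show ?case by (simp add: F_def)
  next
    case (Suc n) then show ?case using ex[of n] by (auto simp: neq_Nil_conv)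
  qed
  have pre: "m \<le> n \<Longrightarrow> \<exists>v. F n = F m @ v" for m n
  proof (induction n rule: dec_induct)
    case base show ?case by simp
  next
    case (step n) then show ?case using ex[of n] by auto
  qed
  have nth: "F n ! i = F i ! i" if "i < length (F n)" for n i
    using pre[of n i] pre[of i n] that len[of i] by (metis nat_le_linear nth_append)
  define y where "y = smap (\<lambda>i. F i ! i) nats"
  have y: "\<forall>n. stake (length (F n)) y = F n"
    by (auto intro!: nth_equalityI simp: y_def nth)
  have uniq: "x = y" if x: "\<forall>n. stake (length (F n)) x = F n" for x
  proof -
    have "x !! i = y !! i" for i
      using x y len[of i] by (metis stake_nth)
    then show ?thesis by (rule stream_eqI)
  qed
  have eq: "omega_word h a = y"
    unfolding omega_word_def F_def[symmetric] by (rule the_equality) (fact y, fact uniq)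
  show "\<forall>n. stake (length ((morph h ^^ n) [a])) (omega_word h a) = (morph h ^^ n) [a]"
    using y unfolding eq F_def .
  show "sset (omega_word h a) \<subseteq> A"
  proof -
    have "y !! i \<in> A" for i using setA[of i] nth_mem[OF len[of i]] by (auto simp: y_def)
    then show ?thesis by (auto simp: eq sset_range)
  qed
qed

lemma omega_word_f:
  "\<forall>n. stake (length ((morph (f_of k) ^^ n) [1])) (omega_word (f_of k) 1) =
       (morph (f_of k) ^^ n) [1]"
  "sset (omega_word (f_of k) 1) \<subseteq> {1, 2}"
proof -
  have 1: "f_of k 1 = 1 # tl (f_of k 1)" "tl (f_of k 1) \<noteq> []"
    by (auto simp: f_of_def f4_def f8_def f12_def)
  have 2: "f_of k b \<noteq> [] \<and> set (f_of k b) \<subseteq> {1, 2}" if "b \<in> {1, 2}" for b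
    using that by (auto simp: f_of_def f4_def f8_def f12_def)
  show "\<forall>n. stake (length ((morph (f_of k) ^^ n) [1])) (omega_word (f_of k) 1) =
       (morph (f_of k) ^^ n) [1]"
    by (rule omega_word_exists(1)[where h = "f_of k" and a = 1 and A = "{1, 2}", OF 1])
      (use 2 in auto)
  show "sset (omega_word (f_of k) 1) \<subseteq> {1, 2}"
    by (rule omega_word_exists(2)[where h = "f_of k" and a = 1 and A = "{1, 2}", OF 1])
      (use 2 in auto)
qed

lemma smorph_g:
  assumes "sset x \<subseteq> {1, 2}"
  shows "smorph g x !! i \<in> {1,2,3} \<and> (smorph g x !! i = 3 \<longrightarrow> smorph g x !! Suc i \<noteq> 3)"
  using assms
proof (induction i arbitrary: x rule: less_induct)
  case (less i)
  obtain b y where x: "x = b ## y" by (cases x)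
  have b: "b = 1 \<or> b = 2" and y: "sset y \<subseteq> {1, 2}" using less.prems x by auto
  have eq: "smorph g x = g b @- smorph g y"
    using b by (auto simp: x smorph_def g_def)
  have "i < length (g b) \<or> (length (g b) \<le> i \<and> i - length (g b) < i)"
    using b by (auto simp: g_def)
  then show ?case
  proof
    assume "i < length (g b)"
    then have "i = 0 \<or> i = 1 \<or> i = 2 \<and> b = 2" using b by (auto simp: g_def split: if_splits)
    then show ?thesis using b unfolding eq by (auto simp: g_def numeral_2_eq_2)
  next
    assume i: "length (g b) \<le> i \<and> i - length (g b) < i"
    have "smorph g x !! i = smorph g y !! (i - length (g b))"
      and "smorph g x !! Suc i = smorph g y !! Suc (i - length (g b))"
      using i by (auto simp: eq Suc_diff_le simp del: snth.simps)
    then show ?thesis using less.IH[of "i - length (g b)" y] i y by simp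
  qed
qed

lemma last_pos_Nil [simp]: "last_pos [] a = 0"
  by (simp add: last_pos_def)

lemma last_pos_le: "last_pos p a \<le> length p"
proof -
  have "finite {Suc i | i. i < length p \<and> p ! i = a}" by simp
  then show ?thesis by (auto simp: last_pos_def)
qed

lemma last_pos_snoc: "last_pos (p @ [a]) b = (if b = a then Suc (length p) else last_pos p b)"
proof (cases "b = a")
  case True
  have "Max (insert 0 {Suc i | i. i < length (p @ [a]) \<and> (p @ [a]) ! i = a}) = Suc (length p)"
    by (rule Max_eqI) auto
  then show ?thesis using True by (simp add: last_pos_def)
next
  case False
  then have "{Suc i | i. i < length (p @ [a]) \<and> (p @ [a]) ! i = b} =
             {Suc i | i. i < length p \<and> p ! i = b}"
    by (auto simp: nth_append less_Suc_eq)
  then show ?thesis using False by (simp add: last_pos_def)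
qed

lemma last_pos_upt: "last_pos [1..<Suc m] a = (if 1 \<le> a \<and> a \<le> m then a else 0)"
proof (induction m)
  case 0 show ?case by simp
next
  case (Suc m)
  have eq: "[1..<Suc (Suc m)] = [1..<Suc m] @ [Suc m]" by simp
  have "length [1..<Suc m] = m" by simp
  then show ?case unfolding eq last_pos_snoc Suc.IH by simp
qed

lemma ranking_snoc:
  assumes inj: "inj_on (last_pos p) {1..k}" and a: "a \<in> {1..k}"
  shows "ranking k (p @ [a]) = remove1 a (ranking k p) @ [a]"
    and "inj_on (last_pos (p @ [a])) {1..k}"
proof -
  show i: "inj_on (last_pos (p @ [a])) {1..k}"
  proof (rule inj_onI)
    fix b c assume bc: "b \<in> {1..k}" "c \<in> {1..k}" "last_pos (p @ [a]) b = last_pos (p @ [a]) c"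
    then show "b = c"
      using inj_onD[OF inj _ bc(1,2)] last_pos_le[of p b] last_pos_le[of p c]
      unfolding last_pos_snoc by (simp split: if_splits)
  qed
  have d: "distinct (ranking k p)" and s: "set (ranking k p) = {1..k}"
    by (auto simp: ranking_def)
  have st: "sorted (map (last_pos p) (ranking k p))" by (simp add: ranking_def)
  have "sorted (map (last_pos p) (remove1 a (ranking k p)))"
    using st by (rule sorted_map_remove1)
  moreover have "map (last_pos (p @ [a])) (remove1 a (ranking k p)) =
      map (last_pos p) (remove1 a (ranking k p))"
    by (rule map_cong[OF refl]) (use d in \<open>simp add: last_pos_snoc\<close>)
  ultimately have "sorted (map (last_pos (p @ [a])) (remove1 a (ranking k p)))" by metis
  moreover have "last_pos (p @ [a]) b \<le> last_pos (p @ [a]) a" for b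
    using last_pos_le[of p b] by (simp add: last_pos_snoc)
  ultimately have so: "sorted (map (last_pos (p @ [a])) (remove1 a (ranking k p) @ [a]))"
    by (simp add: sorted_append)
  have "mset (remove1 a (ranking k p) @ [a]) = mset (ranking k p)"
    using a s by simp
  then have m: "mset [1..<Suc k] = mset (remove1 a (ranking k p) @ [a])"
    by (simp add: ranking_def)
  show "ranking k (p @ [a]) = remove1 a (ranking k p) @ [a]"
    unfolding ranking_def[of k "p @ [a]"]
    by (rule sort_key_inj_key_eq[OF m _ so])
      (use i in \<open>simp only: set_upt atLeastLessThanSuc_atLeastAtMost\<close>)
qed

lemma ranking_upt:
  assumes "k \<ge> 1"
  shows "ranking k [1..<k] = k # [1..<k]" and "inj_on (last_pos [1..<k]) {1..k}"
proof -
  obtain m where k: "k = Suc m" using assms by (cases k) auto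
  show i: "inj_on (last_pos [1..<k]) {1..k}"
    unfolding k last_pos_upt by (auto simp: inj_on_def split: if_splits)
  have "map (last_pos [1..<k]) (k # [1..<k]) = 0 # [1..<k]"
    unfolding k list.map last_pos_upt by (auto intro!: map_idI)
  then have so: "sorted (map (last_pos [1..<k]) (k # [1..<k]))" by simp
  have m: "mset [1..<Suc k] = mset (k # [1..<k])" using assms by simp
  show "ranking k [1..<k] = k # [1..<k]"
    unfolding ranking_def
    by (rule sort_key_inj_key_eq[OF m _ so])
      (use i in \<open>simp only: set_upt atLeastLessThanSuc_atLeastAtMost\<close>)
qed

fun decode_ranks :: "nat \<Rightarrow> nat stream \<Rightarrow> nat \<Rightarrow> nat list" where
  "decode_ranks k t 0 = k # [1..<k]"
| "decode_ranks k t (Suc i) =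
     (let r = decode_ranks k t i; a = r ! (t !! i - 1) in remove1 a r @ [a])"

definition decode :: "nat \<Rightarrow> nat stream \<Rightarrow> nat stream" where
  "decode k t = [1..<k] @- smap (\<lambda>i. decode_ranks k t i ! (t !! i - 1)) nats"

lemma set_stake: "set (stake n s) = snth s ` {..<n}"
  by (induction n) (auto simp: stake_Suc lessThan_Suc simp del: stake.simps(2))

lemma three_heads: "3 \<le> length xs \<Longrightarrow> \<exists>a b c l. xs = a # b # c # l"
  by (auto simp: Suc_le_length_iff numeral_3_eq_3)

lemma decode_encoding:
  assumes k: "k \<ge> 4" and t: "\<And>i. t !! i \<in> {1,2,3}"
    and t33: "\<And>i. t !! i = 3 \<Longrightarrow> t !! Suc i \<noteq> 3"
  shows "stake (k - 1) (decode k t) = [1..<k]" "encodable k (decode k t)"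
    "encoding k (decode k t) = t"
proof -
  define w where "w = decode k t"
  define R where "R = decode_ranks k t"
  define P where "P i = stake (k - 1 + i) w" for i
  have stk: "stake (k - 1) w = [1..<k]"
    by (simp add: w_def decode_def stake_shift)
  then have stk': "stake (k - Suc 0) w = [Suc 0..<k]" by simp
  have wi: "w !! (k - 1 + i) = R i ! (t !! i - 1)" for i
    by (simp add: w_def decode_def R_def)
  have P0: "P 0 = [1..<k]" using stk by (simp add: P_def)
  have PS: "P (Suc i) = P i @ [w !! (k - 1 + i)]" for i
    unfolding P_def add_Suc_right by (rule stake_Suc)
  have setR: "set (ranking k p) = {1..k}" and disR: "distinct (ranking k p)"
    and lenR: "length (ranking k p) = k" for p
    by (auto simp: ranking_def)
  have tk: "t !! i - 1 < k" for i using t[of i] k by auto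
  have inv: "inj_on (last_pos (P i)) {1..k} \<and> R i = ranking k (P i)" for i
  proof (induction i)
    case 0 show ?case using ranking_upt[of k] k by (simp add: P0 R_def)
  next
    case (Suc i)
    have a: "R i ! (t !! i - 1) \<in> {1..k}"
      using Suc setR lenR tk by (metis nth_mem)
    have "R (Suc i) = remove1 (R i ! (t !! i - 1)) (R i) @ [R i ! (t !! i - 1)]"
      by (simp add: R_def Let_def)
    then show ?case
      using ranking_snoc[of "P i" k, OF _ a] Suc unfolding PS wi by metis
  qed
  have sR: "set (R i) = {1..k}" and dR: "distinct (R i)" and lR: "length (R i) = k" for i
    using inv setR disR lenR by auto
  have RS: "R (Suc i) = remove1 (w !! (k - 1 + i)) (R i) @ [w !! (k - 1 + i)]" for i
    unfolding wi by (simp add: R_def Let_def)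
  have dropS: "drop 2 (R (Suc i)) = drop 1 (drop 2 (R i)) @ [w !! (k - 1 + i)]" for i
  proof -
    obtain a b c l where R4: "R i = a # b # c # l"
      using lR[of i] k three_heads[of "R i"] by auto
    have "w !! (k - 1 + i) \<in> {a, b, c}"
      using wi[of i] t[of i] by (auto simp: R4)
    then show ?thesis using dR[of i] unfolding RS by (auto simp: R4)
  qed
  have suf: "drop 2 (R i) = stake (k - 2) (sdrop (Suc i) w)" for i
  proof (induction i)
    case 0
    have "drop 2 (R 0) = drop 1 (stake (k - 1) w)" by (simp add: R_def stk')
    also have "\<dots> = stake (k - 2) (sdrop (Suc 0) w)"
      by (simp add: drop_stake numeral_2_eq_2)
    finally show ?case .
  next
    case (Suc i)
    have "sdrop (Suc i) w !! (k - 2) = w !! (k - 1 + i)"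
      unfolding sdrop_snth using k by (intro arg_cong[where f = "snth w"]) simp
    then have "drop 2 (R (Suc i)) =
        drop 1 (stake (k - 2) (sdrop (Suc i) w) @ [sdrop (Suc i) w !! (k - 2)])"
      using k unfolding dropS Suc by simp
    also have "\<dots> = drop 1 (stake (Suc (k - 2)) (sdrop (Suc i) w))"
      by (simp only: stake_Suc)
    also have "\<dots> = stake (k - 2) (sdrop (Suc (Suc i)) w)"
      by (simp add: drop_stake)
    finally show ?case .
  qed
  have wset: "w !! n \<in> {1..k}" for n
  proof (cases "n < k - 1")
    case True
    then have "w !! n = [1..<k] ! n" using stk by (metis stake_nth)
    then show ?thesis using True by simp
  next
    case False
    then obtain i where "n = k - 1 + i" by (metis le_Suc_ex not_less)
    then show ?thesis using wi sR lR tk by (metis nth_mem)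
  qed
  have ss: "sset w \<subseteq> {1..k}" using wset by (auto simp: sset_range)
  have c1: "k - 1 \<le> card (sset w)"
  proof -
    have "set (stake (k - 1) w) \<subseteq> sset w" by (auto simp: set_stake)
    then have "card (set (stake (k - 1) w)) \<le> card (sset w)"
      using ss by (meson card_mono finite_atLeastAtMost finite_subset)
    then show ?thesis by (simp add: stk')
  qed
  have d2: "distinct (stake (k - 2) (sdrop i w))" for i
  proof (cases i)
    case 0
    have "stake (k - 2) w = take (k - 2) (stake (k - 1) w)" by (simp add: take_stake)
    then show ?thesis using 0 by (simp add: stk')
  next
    case (Suc j) then show ?thesis using suf[of j] dR[of j] by (metis distinct_drop)
  qed
  have ck: "k - 1 \<le> card (set (stake k (sdrop i w)))" for i
  proof (cases i)
    case 0
    have "set (stake (k - 1) w) \<subseteq> set (stake k w)" by (auto simp: set_stake)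
    then have "card (set (stake (k - 1) w)) \<le> card (set (stake k w))"
      by (intro card_mono) auto
    then show ?thesis using 0 by (simp add: stk')
  next
    case (Suc j)
    let ?x = "stake (k - 2) (sdrop i w)"
    let ?a = "w !! (k - 1 + j)" and ?b = "w !! (k - 1 + Suc j)"
    have "k = Suc (Suc (k - 2))" using k by simp
    then have "stake k (sdrop i w) =
        ?x @ [sdrop i w !! (k - 2)] @ [sdrop i w !! Suc (k - 2)]"
      by (metis stake_Suc append_assoc)
    moreover have "sdrop i w !! (k - 2) = ?a" "sdrop i w !! Suc (k - 2) = ?b"
      unfolding sdrop_snth Suc using k by (intro arg_cong[where f = "snth w"]; simp)+
    ultimately have z: "stake k (sdrop i w) = ?x @ [?a, ?b]" by simp
    obtain a b c l where R4: "R j = a # b # c # l"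
      using lR[of j] k three_heads[of "R j"] by auto
    have x: "?x = c # l" using suf[of j] by (simp add: R4 Suc del: sdrop.simps)
    have "?a \<notin> set ?x \<or> ?b \<notin> set ?x"
    proof (cases "t !! j = 3")
      case False
      then have "?a \<in> {a, b}" using wi[of j] t[of j] by (auto simp: R4)
      then show ?thesis using dR[of j] by (auto simp: x R4)
    next
      case True
      then have "?a = c" using wi[of j] by (simp add: R4)
      then have "R (Suc j) = a # b # l @ [c]" using dR[of j] by (auto simp: RS R4)
      moreover have "t !! Suc j \<in> {1, 2}" using t33[OF True] t[of "Suc j"] by auto
      ultimately have "?b \<in> {a, b}" using wi[of "Suc j"] by (auto simp del: snth.simps)
      then show ?thesis using dR[of j] by (auto simp: x R4)
    qed
    then obtain e where e: "e \<notin> set ?x" "insert e (set ?x) \<subseteq> set (stake k (sdrop i w))"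
      unfolding z by auto
    have "card (insert e (set ?x)) = Suc (k - 2)"
      using e(1) d2[of i] by (simp add: distinct_card)
    then show ?thesis using card_mono[OF _ e(2)] k by simp
  qed
  show "stake (k - 1) (decode k t) = [1..<k]" using stk by (simp add: w_def)
  show "encodable k (decode k t)"
    unfolding w_def[symmetric] encodable_def factors_def
    using ss c1 d2 ck by (auto simp: distinct_card)
  have il: "init_len k w = k - 1"
    unfolding init_len_def
  proof (rule Least_equality)
    show "card (set (stake (k - 1) w)) = k - 1" by (simp add: stk')
    show "k - 1 \<le> m" if "card (set (stake m w)) = k - 1" for m
      using card_length[of "stake m w"] that by simp
  qed
  have "encoding k w !! i = t !! i" for i
  proof -
    have r: "ranking k (stake (k - 1 + i) w) = R i" using inv[of i] by (simp add: P_def)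
    have "(THE j. j \<in> {1,2,3} \<and> R i ! (t !! i - 1) = R i ! (j - 1)) = t !! i"
    proof (rule the_equality)
      show "t !! i \<in> {1,2,3} \<and> R i ! (t !! i - 1) = R i ! (t !! i - 1)" using t by simp
      fix j assume j: "j \<in> {1,2,3} \<and> R i ! (t !! i - 1) = R i ! (j - 1)"
      then have "j - 1 < k" using k by auto
      then have "t !! i - 1 = j - 1"
        using j dR[of i] lR[of i] tk[of i] nth_eq_iff_index_eq by metis
      then show "j = t !! i" using j t[of i] by auto
    qed
    moreover have "encoding k w !! i =
        (THE j. j \<in> {1,2,3} \<and> w !! (k - 1 + i) = ranking k (stake (k - 1 + i) w) ! (j - 1))"
      unfolding encoding_def il by simp
    ultimately show ?thesis unfolding r wi by simp
  qed
  then show "encoding k (decode k t) = t"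
    unfolding w_def by (rule stream_eqI)
qed

lemma encoded_word_exists:
  assumes "k \<in> {4, 8, 12}"
  shows "\<exists>w. sset w \<subseteq> {1..k} \<and> stake (k - 1) w = [1..<k] \<and> encodable k w \<and>
             encoding k w = smorph g (omega_word (f_of k) 1)"
proof -
  let ?t = "smorph g (omega_word (f_of k) 1)"
  have t: "?t !! i \<in> {1,2,3}" and t33: "?t !! i = 3 \<Longrightarrow> ?t !! Suc i \<noteq> 3" for i
    using smorph_g[OF omega_word_f(2)[of k], of i] by blast+
  have k: "k \<ge> 4" using assms by auto
  show ?thesis using decode_encoding[OF k t t33] unfolding encodable_def by blast
qed

end

theory Submission
  imports Defs
begin

text \<open>
  Let \<open>X\<close> be the fixed point of \<open>f\<close>. A block \<open>31\<close> or \<open>312\<close> of the encoding turns the ranking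
  \<open>a b c d l\<close> into \<open>b d l c a\<close> or \<open>b l c a d\<close>, and the factor \<open>b c\<close> or \<open>b c d\<close> of \<open>w\<close> belongs to
  it. Letters of \<open>w\<close> at distance \<open>k - 2\<close> agree exactly at the starts of blocks, so a long
  repetition in \<open>w\<close> comes from two equal rankings at some distance \<open>P\<close> in \<open>X\<close>, followed by a common
  factor of \<open>X\<close> of some length \<open>Q\<close> (a kernel repetition in the sense of Moulin Ollagnier). Since \<open>f\<close>
  is synchronizing and acts on rankings like the single letters do, up to conjugation by a
  permutation, long kernel repetitions are images of shorter ones. Hence a linear lower bound
  for \<open>P\<close> in terms of \<open>Q\<close> follows from the case of small \<open>Q\<close>.

  A reversed repetition in \<open>w\<close> likewise yields a factor of \<open>X\<close> whose reversal is a factor, and the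
  length of those is bounded. What remains concerns factors of \<open>w\<close> of bounded length. Up to
  renaming letters these are determined by factors of \<open>X\<close>, so finitely many searches suffice.
\<close>

section \<open>Words generated by rankings\<close>

definition block_len :: "bool \<Rightarrow> nat" where
  "block_len b = (if b then 3 else 2)"

text \<open>The effect of the block \<open>31\<close> (\<open>False\<close>) or \<open>312\<close> (\<open>True\<close>) on a ranking.\<close>

fun step :: "bool \<Rightarrow> 'a list \<Rightarrow> 'a list" where
  "step False (a # b # c # d # l) = b # d # l @ [c, a]"
| "step True (a # b # c # d # l) = b # l @ [c, a, d]"
| "step _ l = l"

text \<open>When a reflection of \<open>w\<close> exchanges two block starts, the rankings there are
  related in this way: the fresh letter \<open>s ! 0\<close> of one block opens the window of the
  other, and the repeated letter \<open>s ! 2\<close> is common.\<close>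

definition mirrored :: "'a list \<Rightarrow> 'a list \<Rightarrow> bool" where
  "mirrored s s' \<longleftrightarrow> s ! 0 = s' ! 1 \<and> s ! 1 = s' ! 0 \<and> s ! 2 = s' ! 2"

lemma four_heads: "4 \<le> length xs \<Longrightarrow> \<exists>a b c d l. xs = a # b # c # d # l"
  by (auto simp: Suc_le_length_iff numeral_eq_Suc)

text \<open>\<open>T q\<close> is the start of the window of \<open>k - 1\<close> letters preceding
  those coded by block \<open>q\<close>; the window is the ranking \<open>s q\<close> without its
  first entry.\<close>

locale coded_word =
  fixes k :: nat and X :: "nat \<Rightarrow> bool" and s :: "nat \<Rightarrow> 'a list" and T :: "nat \<Rightarrow> nat"
    and w :: "nat \<Rightarrow> 'a"
  assumes k4: "4 \<le> k"
    and len_s: "length (s q) = k"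
    and dist_s: "distinct (s q)"
    and set_s: "set (s q) = set (s 0)"
    and s_Suc: "s (Suc q) = step (X q) (s q)"
    and T_0: "T 0 = 0"
    and T_Suc: "T (Suc q) = T q + block_len (X q)"
    and w_T: "l < k - 1 \<Longrightarrow> w (T q + l) = s q ! Suc l"
    and no_cube: "\<not> (X q = X (Suc q) \<and> X (Suc q) = X (Suc (Suc q)))"
begin

lemma s_conv:
  obtains a b c d l where "s q = a # b # c # d # l" "k = length l + 4"
  using four_heads[of "s q"] len_s[of q] k4 by auto

text \<open>Every block codes \<open>3\<close> and then \<open>1\<close>, so the two letters after
  the window have ranks 3 and 1. They are found in the window of the next block.\<close>

lemma w_repeat: "w (T q + (k - 1)) = s q ! 2" and w_fresh: "w (T q + k) = s q ! 0"
proof -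
  obtain a b c d l where s: "s q = a # b # c # d # l" and k: "k = length l + 4"
    by (rule s_conv)
  have "w (T q + (k - 1)) = c \<and> w (T q + k) = a"
  proof (cases "X q")
    case True
    then have s': "s (Suc q) = b # l @ [c, a, d]" by (simp add: s_Suc s)
    have T: "T q + (k - 1) = T (Suc q) + length l" "T q + k = T (Suc q) + Suc (length l)"
      using True by (simp_all add: T_Suc block_len_def k)
    show ?thesis unfolding T using w_T[of "length l" "Suc q"] w_T[of "Suc (length l)" "Suc q"]
      by (simp add: k s' nth_append)
  next
    case False
    then have s': "s (Suc q) = b # d # l @ [c, a]" by (simp add: s_Suc s)
    have T: "T q + (k - 1) = T (Suc q) + Suc (length l)"
      "T q + k = T (Suc q) + Suc (Suc (length l))"
      using False by (simp_all add: T_Suc block_len_def k)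
    show ?thesis unfolding T
      using w_T[of "Suc (length l)" "Suc q"] w_T[of "Suc (Suc (length l))" "Suc q"]
      by (simp add: k s' nth_append)
  qed
  then show "w (T q + (k - 1)) = s q ! 2" "w (T q + k) = s q ! 0" by (simp_all add: s)
qed

section \<open>Positions of block starts\<close>

lemma T_mono: "p < q \<Longrightarrow> T p < T q"
  by (induction q) (auto simp: T_Suc block_len_def less_Suc_eq)

lemma T_less_iff: "T p < T q \<longleftrightarrow> p < q"
  using T_mono by (metis less_asym linorder_neqE_nat order_less_irrefl)

lemma T_le_iff: "T p \<le> T q \<longleftrightarrow> p \<le> q"
  using T_less_iff by (meson leD leI)

lemma T_ge: "q \<le> T q"
  by (induction q) (auto simp: T_Suc block_len_def)

lemma T_Suc_bounds: "T q + 2 \<le> T (Suc q)" "T (Suc q) \<le> T q + 3"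
  by (auto simp: T_Suc block_len_def)

lemma T_greatest:
  obtains q where "T q \<le> m" "m < T (Suc q)"
proof -
  have "\<exists>q. m < T (Suc q)" using T_ge[of "Suc m"] by (intro exI[of _ m]) simp
  define q where "q = (LEAST q. m < T (Suc q))"
  have 1: "m < T (Suc q)" unfolding q_def by (rule LeastI_ex) fact
  have "T q \<le> m"
  proof (cases q)
    case 0 then show ?thesis by (simp add: T_0)
  next
    case (Suc p)
    then have "p < (LEAST q. m < T (Suc q))" by (simp add: q_def)
    then have "\<not> m < T (Suc p)" by (rule not_less_Least)
    then show ?thesis by (simp add: Suc)
  qed
  then show ?thesis using 1 that by blast
qed

text \<open>The code letter \<open>3\<close> repeats the letter \<open>k - 2\<close> places back,
  the code letters \<open>1\<close> and \<open>2\<close> do not, and \<open>3\<close> occurs only at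
  the head of a block. Hence block starts are visible in \<open>w\<close> itself.\<close>

lemma repeat_iff: "w m = w (m + (k - 2)) \<longleftrightarrow> (\<exists>q. m = Suc (T q))"
proof -
  obtain q where q: "T q \<le> m" "m < T (Suc q)" by (rule T_greatest)
  obtain a b c d l where s: "s q = a # b # c # d # l" and k: "k = length l + 4"
    by (rule s_conv)
  have d: "distinct (a # b # c # d # l)" using dist_s[of q] by (simp add: s)
  have "m = T q \<or> m = Suc (T q) \<or> m = T q + 2 \<and> X q"
    using q by (auto simp: T_Suc block_len_def split: if_splits)
  then consider "m = T q" | "m = Suc (T q)" | "m = T q + 2" "X q" by blast
  then show ?thesis
  proof cases
    case 1
    have "w m = b" using w_T[of 0 q] k by (simp add: 1 s)
    moreover have "w (m + (k - 2)) = (d # l) ! length l"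
      using w_T[of "k - 2" q] k by (simp add: 1 s)
    moreover have "(d # l) ! length l \<in> set (d # l)" by (rule nth_mem) simp
    ultimately have "w m \<noteq> w (m + (k - 2))" using d by auto
    moreover have "m \<noteq> Suc (T p)" for p
    proof
      assume "m = Suc (T p)"
      then have "p < q" using 1 T_less_iff[of p q] by simp
      then have "T (Suc p) \<le> T q" by (simp add: T_le_iff)
      then show False using \<open>m = Suc (T p)\<close> 1 T_Suc_bounds(1)[of p] by simp
    qed
    ultimately show ?thesis by blast
  next
    case 2
    have "w m = c" using w_T[of 1 q] k by (simp add: 2 s)
    moreover have "m + (k - 2) = T q + (k - 1)" using k 2 by simp
    then have "w (m + (k - 2)) = c" using w_repeat[of q] by (simp add: s)
    ultimately show ?thesis using 2 by auto
  next
    case 3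
    have "w m = d" using w_T[of 2 q] k by (simp add: 3 s numeral_eq_Suc)
    moreover have "m + (k - 2) = T q + k" using k 3 by simp
    then have "w (m + (k - 2)) = a" using w_fresh[of q] by (simp add: s)
    ultimately have "w m \<noteq> w (m + (k - 2))" using d by auto
    moreover have "m \<noteq> Suc (T p)" for p
    proof
      assume "m = Suc (T p)"
      then have "T p = Suc (T q)" using 3 by simp
      then have "q < p" "p < Suc q" using T_less_iff[of q p] T_less_iff[of p "Suc q"] 3
        by (auto simp: T_Suc block_len_def)
      then show False by simp
    qed
    ultimately show ?thesis by blast
  qed
qed

lemma T_plus_2_iff: "(\<exists>b. T a + 2 = T b) \<longleftrightarrow> \<not> X a"
proof
  assume "\<exists>b. T a + 2 = T b"
  then obtain b where b: "T a + 2 = T b" by blast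
  then have "a < b" using T_less_iff[of a b] by simp
  show "\<not> X a"
  proof
    assume "X a"
    then have "T b < T (Suc a)" using b by (simp add: T_Suc block_len_def)
    then show False using \<open>a < b\<close> T_less_iff by simp
  qed
next
  assume "\<not> X a" then show "\<exists>b. T a + 2 = T b"
    by (intro exI[of _ "Suc a"]) (simp add: T_Suc block_len_def)
qed

lemma T_plus_3_iff: "(\<exists>b. T a + 3 = T b) \<longleftrightarrow> X a"
proof
  assume "\<exists>b. T a + 3 = T b"
  then obtain b where b: "T a + 3 = T b" by blast
  show "X a"
  proof (rule ccontr)
    assume "\<not> X a"
    then have "T (Suc a) < T b" "T b < T (Suc (Suc a))"
      using b T_Suc_bounds(1)[of "Suc a"] by (simp_all add: T_Suc block_len_def)
    then show False using T_less_iff by simp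
  qed
next
  assume "X a" then show "\<exists>b. T a + 3 = T b"
    by (intro exI[of _ "Suc a"]) (simp add: T_Suc block_len_def)
qed

text \<open>Three consecutive blocks are not all equal, so together they have length 7 or 8. The
  additive \<open>2\<close> covers the one or two blocks left over.\<close>

lemma T_bounds: "7 * m \<le> 3 * (T (q + m) - T q) + 2 \<and> 3 * (T (q + m) - T q) \<le> 8 * m + 2"
proof (induction m arbitrary: q rule: less_induct)
  case (less m)
  have mono: "T q \<le> T (q + n)" for q n by (simp add: T_le_iff)
  have "m = 0 \<or> m = 1 \<or> m = 2 \<or> m = (m - 3) + 3" by linarith
  then consider "m = 0" | "m = 1" | "m = 2" | n where "m = n + 3" by blast
  then show ?case
  proof cases
    case 4
    have "7 * n \<le> 3 * (T (q + 3 + n) - T (q + 3)) + 2"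
      "3 * (T (q + 3 + n) - T (q + 3)) \<le> 8 * n + 2"
      using less[of n "q + 3"] 4 by simp_all
    moreover have "T q + 7 \<le> T (q + 3)" "T (q + 3) \<le> T q + 8"
      using no_cube[of q] by (auto simp: numeral_3_eq_3 T_Suc block_len_def)
    moreover obtain a where a: "T (q + 3 + n) = T (q + 3) + a" using mono le_Suc_ex by blast
    moreover obtain b where b: "T (q + 3) = T q + b" using mono le_Suc_ex by blast
    ultimately have "7 * (n + 3) \<le> 3 * (b + a) + 2 \<and> 3 * (b + a) \<le> 8 * (n + 3) + 2"
      by simp
    moreover have "T (q + m) = T q + (b + a)" using a b by (simp add: 4 add.assoc add.commute[of 3])
    ultimately show ?thesis by (simp add: 4)
  qed (auto simp: numeral_2_eq_2 T_Suc block_len_def)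
qed

text \<open>Extending the run to \<open>q - 1\<close> on the left and \<open>Suc e\<close> on the
  right adds two blocks and at least two letters, and \<open>8 * 2 + 2 - 3 * 2 = 12\<close>.\<close>

lemma block_run_bounds:
  assumes "T q \<ge> i" "q = 0 \<or> T (q - 1) < i" "q \<le> e" "T e \<le> u" "u < T (Suc e)" "i \<le> u"
  shows "3 * (u - i) \<le> 8 * (e - q) + 12"
proof (cases "q = 0")
  case True
  have "3 * T (Suc e) \<le> 8 * Suc e + 2" using T_bounds[of "Suc e" 0] by (simp add: T_0)
  then show ?thesis using True assms by simp
next
  case False
  have "3 * (T (Suc e) - T (q - 1)) \<le> 8 * (Suc e - (q - 1)) + 2"
    using T_bounds[of "Suc e - (q - 1)" "q - 1"] assms by simp
  moreover have "Suc e - (q - 1) = e - q + 2" using False assms by simp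
  moreover have "u - i + 2 \<le> T (Suc e) - T (q - 1)" using assms False by linarith
  ultimately show ?thesis by linarith
qed

lemma T_least:
  obtains q where "T q \<ge> i" "q = 0 \<or> T (q - 1) < i"
proof (cases "i = 0")
  case True then show ?thesis using that[of 0] by simp
next
  case False
  obtain q where "T q \<le> i - 1" "i - 1 < T (Suc q)" by (rule T_greatest)
  then show ?thesis using False by (intro that[of "Suc q"]) auto
qed

text \<open>The window shows all entries but the first, and that one is the only letter left
  over.\<close>

lemma s_eqI:
  assumes "\<And>l. l < k - 1 \<Longrightarrow> w (T q + l) = w (T q' + l)"
  shows "s q = s q'"
proof -
  obtain a b where s: "s q = a # b" using len_s[of q] k4 by (cases "s q") auto
  obtain a' b' where s': "s q' = a' # b'" using len_s[of q'] k4 by (cases "s q'") auto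
  have "length b = k - 1" "length b' = k - 1" using len_s[of q] len_s[of q'] s s' by auto
  moreover have "b ! l = b' ! l" if "l < k - 1" for l
    using assms[OF that] w_T[OF that, of q] w_T[OF that, of q'] by (simp add: s s')
  ultimately have b: "b = b'" by (auto intro: nth_equalityI)
  have "set (s q) = set (s q')" using set_s by metis
  then have "a = a'" using dist_s[of q] dist_s[of q'] by (auto simp: s s' b)
  then show ?thesis by (simp add: s s' b)
qed

text \<open>Block starts are visible in the letters, so the shift by \<open>p\<close> takes block
  starts to block starts. Their distances 2 and 3 reveal the letters of \<open>X\<close>, which
  therefore agree as well.\<close>

lemma repetition_kernel:
  assumes n: "k + 2 \<le> n" and p: "0 < p" and rep: "\<And>l. l < n \<Longrightarrow> w (i + l) = w (i + p + l)"
  obtains q P Q where "T (q + P) = T q + p" "0 < P" "s q = s (q + P)"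
    "\<And>l. l < Q \<Longrightarrow> X (q + l) = X (q + P + l)" "3 * n \<le> 8 * Q + 12 + 3 * k"
proof -
  have rep': "w m = w (m + p)" if "i \<le> m" "m < i + n" for m
    using rep[of "m - i"] that by (simp add: algebra_simps)
  obtain q where q: "T q \<ge> i" "q = 0 \<or> T (q - 1) < i" by (rule T_least)
  have qi: "T q \<le> i + 2"
    using q T_Suc_bounds(2)[of "q - 1"] by (cases q) (auto simp: T_0)
  \<comment> \<open>Up to block \<open>e\<close> the window and the repeated letter after it stay
    inside the repetition, so \<open>repeat_iff\<close> applies to both copies.\<close>
  obtain e where e: "T e \<le> i + n - k" "i + n - k < T (Suc e)" by (rule T_greatest)
  have qe: "q \<le> e"
  proof (rule ccontr)
    assume "\<not> q \<le> e"
    then have "T (Suc e) \<le> T q" by (simp add: T_le_iff)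
    then show False using e qi n by simp
  qed
  have shift: "\<exists>b. T a + p = T b" if "q \<le> a" "a \<le> e" for a
  proof -
    have a: "i \<le> T a" "T a + k \<le> i + n"
      using that q e n T_le_iff[of q a] T_le_iff[of a e] by simp_all
    have "w (Suc (T a)) = w (Suc (T a) + (k - 2))" using repeat_iff by blast
    moreover have "w (Suc (T a)) = w (Suc (T a) + p)" using a k4 by (intro rep') auto
    moreover have "w (Suc (T a) + (k - 2)) = w (Suc (T a) + (k - 2) + p)"
      using a k4 by (intro rep') auto
    ultimately have "w (Suc (T a) + p) = w (Suc (T a) + p + (k - 2))" by (simp add: algebra_simps)
    then show ?thesis using repeat_iff[of "Suc (T a) + p"] by auto
  qed
  obtain b where b: "T q + p = T b" using shift qe by blast
  then have "q < b" using p T_less_iff[of q b] by simp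
  define P where "P = b - q"
  have P: "0 < P" "T (q + P) = T q + p" using b \<open>q < b\<close> by (auto simp: P_def)
  have run: "l \<le> e - q \<Longrightarrow> T (q + P + l) = T (q + l) + p \<and> (\<forall>j<l. X (q + j) = X (q + P + j))" for l
  proof (induction l)
    case 0 show ?case using P by simp
  next
    case (Suc l)
    then have IH: "T (q + P + l) = T (q + l) + p" "\<forall>j<l. X (q + j) = X (q + P + j)" by auto
    have "q \<le> q + Suc l" "q + Suc l \<le> e" using Suc.prems qe by linarith+
    from shift[OF this] obtain c where c: "T (q + Suc l) + p = T c" by blast
    have "X (q + l) = X (q + P + l)"
    proof (cases "X (q + l)")
      case True
      then have "T (q + P + l) + 3 = T c" using c IH by (simp add: T_Suc block_len_def)
      then show ?thesis using T_plus_3_iff True by blast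
    next
      case False
      then have "T (q + P + l) + 2 = T c" using c IH by (simp add: T_Suc block_len_def)
      then show ?thesis using T_plus_2_iff False by blast
    qed
    then show ?case using IH by (simp add: T_Suc less_Suc_eq)
  qed
  have "s q = s (q + P)"
  proof (rule s_eqI)
    fix l assume "l < k - 1"
    then have "w (T q + l) = w (T q + l + p)" using q qi n by (intro rep') auto
    then show "w (T q + l) = w (T (q + P) + l)" using P by (simp add: algebra_simps)
  qed
  moreover have "3 * n \<le> 8 * (e - q) + 12 + 3 * k"
  proof -
    have "3 * (i + n - k - i) \<le> 8 * (e - q) + 12"
      using q qe e n by (intro block_run_bounds) auto
    then show ?thesis using n by simp
  qed
  ultimately show ?thesis using that[of q P "e - q"] P run[of "e - q"] by simp
qed

text \<open>The reflection of \<open>m\<close> to \<open>C - m\<close> preserves letters, hence also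
  equal letters at distance \<open>k - 2\<close>; it pairs the block start \<open>T a\<close> with
  the block start \<open>T b\<close> such that \<open>T a + T b + k = C\<close>. Reading blocks
  leftwards from \<open>e\<close> then agrees with reading them rightwards from
  \<open>B\<close>.\<close>

lemma reversal_mirrored:
  assumes n: "k + 9 \<le> n" and ij: "i + n \<le> j"
    and rev: "\<And>l. l < n \<Longrightarrow> w (i + l) = w (j + n - 1 - l)"
  obtains e B L where "L \<le> e" "e < B" "T B + k + n \<le> T e + (j - i) + 2 * k + 5"
    "\<And>l. l \<le> L \<Longrightarrow> mirrored (s (e - l)) (s (B + l))"
    "\<And>l. l < L \<Longrightarrow> X (e - Suc l) = X (B + l)"
    "3 * n \<le> 8 * L + 15 + 3 * k"
proof -
  define C where "C = i + j + n - 1"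
  have rev': "w m = w (C - m)" if "i \<le> m" "m < i + n" for m
    using rev[of "m - i"] that by (simp add: C_def algebra_simps)
  obtain q where q: "T q \<ge> i" "q = 0 \<or> T (q - 1) < i" by (rule T_least)
  have qi: "T q \<le> i + 2"
    using q T_Suc_bounds(2)[of "q - 1"] by (cases q) (auto simp: T_0)
  obtain e where e: "T e \<le> i + n - 1 - k" "i + n - 1 - k < T (Suc e)" by (rule T_greatest)
  have qe: "q \<le> e"
  proof (rule ccontr)
    assume "\<not> q \<le> e"
    then have "T (Suc e) \<le> T q" by (simp add: T_le_iff)
    then show False using e qi n by simp
  qed
  have range: "i \<le> T a \<and> T a + k < i + n" if "q \<le> a" "a \<le> e" for a
    using that q e n T_le_iff[of q a] T_le_iff[of a e] by simp
  have flip: "\<exists>b. T a + T b + k = C" if "q \<le> a" "a \<le> e" for a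
  proof -
    note a = range[OF that]
    have "w (Suc (T a)) = w (Suc (T a) + (k - 2))" using repeat_iff by blast
    moreover have "w (Suc (T a)) = w (C - Suc (T a))" using a k4 by (intro rev') auto
    moreover have "w (Suc (T a) + (k - 2)) = w (C - (Suc (T a) + (k - 2)))"
      using a k4 by (intro rev') auto
    moreover have C: "T a + k < C" using a n ij unfolding C_def by linarith
    then have "C - Suc (T a) = C - (Suc (T a) + (k - 2)) + (k - 2)" using k4 by linarith
    ultimately have "\<exists>b. C - (Suc (T a) + (k - 2)) = Suc (T b)"
      using repeat_iff[of "C - (Suc (T a) + (k - 2))"] by metis
    then obtain b where "C - (Suc (T a) + (k - 2)) = Suc (T b)" by blast
    then have "T a + T b + k = C" using C k4 by linarith
    then show ?thesis by blast
  qed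
  have mir: "mirrored (s a) (s b)" if "q \<le> a" "a \<le> e" "T a + T b + k = C" for a b
  proof -
    note a = range[OF that(1,2)]
    \<comment> \<open>The positions \<open>T a + k\<close>, \<open>T a\<close>,
      \<open>T a + 1\<close> show the entries 0, 1, 2 of \<open>s a\<close>; their reflections show
      the entries 1, 0, 2 of \<open>s b\<close>.\<close>
    have "w (T a + k) = w (C - (T a + k))" "w (T a) = w (C - T a)"
      "w (T a + 1) = w (C - (T a + 1))"
      using a k4 by (intro rev'; simp)+
    moreover have "C - (T a + k) = T b" "C - T a = T b + k" "C - (T a + 1) = T b + (k - 1)"
      using that(3) k4 by auto
    ultimately show ?thesis
      using w_fresh[of a] w_fresh[of b] w_repeat[of b] w_T[of 0 a] w_T[of 0 b] w_T[of 1 a] k4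
      by (simp add: mirrored_def numeral_2_eq_2)
  qed
  obtain B where B: "T e + T B + k = C" using flip[OF qe] by blast
  have run: "l \<le> e - q \<Longrightarrow> T (e - l) + T (B + l) + k = C \<and> (\<forall>j<l. X (e - Suc j) = X (B + j))" for l
  proof (induction l)
    case 0 show ?case using B by simp
  next
    case (Suc l)
    then have IH: "T (e - l) + T (B + l) + k = C" "\<forall>j<l. X (e - Suc j) = X (B + j)" by auto
    have el: "e - l = Suc (e - Suc l)" using Suc.prems by simp
    have "q \<le> e - Suc l" "e - Suc l \<le> e" using Suc.prems qe by linarith+
    from flip[OF this] obtain c where c: "T (e - Suc l) + T c + k = C" by blast
    have "X (e - Suc l) = X (B + l)"
    proof (cases "X (e - Suc l)")
      case True
      then have "T (B + l) + 3 = T c" using c IH(1) unfolding el by (simp add: T_Suc block_len_def)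
      then show ?thesis using T_plus_3_iff True by blast
    next
      case False
      then have "T (B + l) + 2 = T c" using c IH(1) unfolding el by (simp add: T_Suc block_len_def)
      then show ?thesis using T_plus_2_iff False by blast
    qed
    then show ?case using IH unfolding el by (auto simp: T_Suc less_Suc_eq)
  qed
  show ?thesis
  proof (rule that[of "e - q" e B])
    have "T e < T B" using B e ij n by (simp add: C_def)
    then show "e < B" by (simp add: T_less_iff)
    show "T B + k + n \<le> T e + (j - i) + 2 * k + 5"
      using B e ij n T_Suc_bounds(2)[of e] by (simp add: C_def)
    show "mirrored (s (e - l)) (s (B + l))" if "l \<le> e - q" for l
      using mir[of "e - l" "B + l"] run[OF that] that qe by simp
    show "X (e - Suc l) = X (B + l)" if "l < e - q" for l
      using run[of "e - q"] that by simp
    have "3 * (i + n - 1 - k - i) \<le> 8 * (e - q) + 12"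
      using q qe e n by (intro block_run_bounds) auto
    then show "3 * n \<le> 8 * (e - q) + 15 + 3 * k" using n by simp
  qed simp
qed

end

section \<open>Descent of kernel repetitions through a uniform morphism\<close>

lemma step_inj:
  assumes "step b l = step b l'" "length l = length l'" "4 \<le> length l"
  shows "l = l'"
  using four_heads[of l] four_heads[of l'] assms by (cases b) auto

text \<open>\<open>sync\<close> and \<open>kernel\<close> allow a kernel repetition with
  \<open>Q \<ge> S\<close> to be pulled back through \<open>f\<close>; \<open>kernel_base\<close>
  handles the shorter ones.\<close>

locale coded_morphic_word = coded_word k X s T w
  for k X and s :: "nat \<Rightarrow> 'a list" and T w +
  fixes f :: "bool \<Rightarrow> bool list" and r S al ga be :: nat
  assumes r2: "2 \<le> r"
    and X_f: "j < r \<Longrightarrow> X (r * m + j) = f (X m) ! j"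
    and last_f: "f False ! (r - 1) \<noteq> f True ! (r - 1)"
    and sync: "(\<And>l. l < S \<Longrightarrow> X (i + l) = X (j + l)) \<Longrightarrow>
      i mod r = j mod r \<and> X (i div r) = X (j div r)"
    and kernel: "s (r * i) = s (r * j) \<Longrightarrow> s i = s j"
    and kernel_base: "\<lbrakk>0 < P; s i = s (i + P); \<And>l. l < Q \<Longrightarrow> X (i + l) = X (i + P + l); Q < S\<rbrakk> \<Longrightarrow>
      ga * (Q + 1) + be \<le> al * P"
begin

text \<open>Since \<open>step\<close> is injective, equality of rankings inside two equal images
  travels back to the starts of the images.\<close>

lemma s_block:
  assumes "X i = X j"
  shows "m \<le> r \<Longrightarrow> s (r * i + m) = s (r * j + m) \<Longrightarrow> s (r * i) = s (r * j)"
proof (induction m)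
  case (Suc m)
  have X: "X (r * i + m) = X (r * j + m)" using Suc.prems(1) assms by (simp add: X_f)
  have "step (X (r * i + m)) (s (r * i + m)) = step (X (r * j + m)) (s (r * j + m))"
    using Suc.prems(2) unfolding add_Suc_right s_Suc .
  then have "step (X (r * j + m)) (s (r * i + m)) = step (X (r * j + m)) (s (r * j + m))"
    unfolding X .
  then have "s (r * i + m) = s (r * j + m)" by (rule step_inj) (simp_all add: len_s k4)
  then show ?case using Suc by simp
qed simp

text \<open>Descent on \<open>P\<close>: for \<open>Q \<ge> S\<close> the repetition is the image of
  one with \<open>P = r * P'\<close> and \<open>Q + 1 \<le> r * (Q' + 1)\<close>. Writing the bound
  with \<open>Q + 1\<close> lets it survive multiplication by \<open>r\<close>, and
  \<open>be \<le> r * be\<close>.\<close>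

lemma kernel_bound:
  "\<lbrakk>0 < P; s i = s (i + P); \<And>l. l < Q \<Longrightarrow> X (i + l) = X (i + P + l)\<rbrakk> \<Longrightarrow>
    ga * (Q + 1) + be \<le> al * P"
proof (induction P arbitrary: i Q rule: less_induct)
  case (less P)
  show ?case
  proof (cases "Q < S")
    case True then show ?thesis using kernel_base less.prems by blast
  next
    case False
    have sy: "i mod r = (i + P) mod r \<and> X (i div r) = X ((i + P) div r)"
      using sync[of i "i + P"] less.prems(3) False by simp
    then have "r dvd P" by (metis add_diff_cancel_left' mod_eq_dvd_iff_nat le_add1)
    then obtain P' where P: "P = r * P'" by blast
    define i' where "i' = i div r"
    define j where "j = i mod r"
    have i: "i = r * i' + j" and j: "j < r" using r2 by (simp_all add: i'_def j_def)
    have iP: "i + P = r * (i' + P') + j" by (simp add: i P algebra_simps)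
    have "X i' = X (i' + P')" using sy iP j by (simp add: i'_def P add.commute)
    then have "s (r * i') = s (r * (i' + P'))"
      using s_block[of i' "i' + P'" j] less.prems(2) j by (metis iP i less_imp_le)
    then have s': "s i' = s (i' + P')" by (rule kernel)
    define e where "e = (i + Q) div r"
    have e: "r * e \<le> i + Q" "i + Q < r * e + r"
      using r2 mult_div_mod_eq[of r "i + Q"] mod_less_divisor[of r "i + Q"]
      unfolding e_def by linarith+
    \<comment> \<open>The last letter of an image determines its preimage. The last positions of the
      images \<open>i'\<close> to \<open>e - 1\<close> lie in the common factor even if
      \<open>i\<close> is strictly inside image \<open>i'\<close>.\<close>
    have X': "X (i' + l) = X (i' + P' + l)" if "l < e - i'" for l
    proof -
      have "r * (i' + l + 1) \<le> r * e" using that by (intro mult_le_mono2) simp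
      then have le: "r * (i' + l) + (r - 1) < i + Q" using e r2 by (simp add: algebra_simps)
      have ge: "i \<le> r * (i' + l) + (r - 1)" using i j by (simp add: algebra_simps)
      have "X (r * (i' + l) + (r - 1)) = X (r * (i' + P' + l) + (r - 1))"
        using less.prems(3)[of "r * (i' + l) + (r - 1) - i"] le ge by (simp add: P algebra_simps)
      then have "f (X (i' + l)) ! (r - 1) = f (X (i' + P' + l)) ! (r - 1)"
        using X_f[of "r - 1" "i' + l"] X_f[of "r - 1" "i' + P' + l"] r2 by simp
      then show ?thesis using last_f by (cases "X (i' + l)"; cases "X (i' + P' + l)") auto
    qed
    have P': "0 < P'" "P' < P" using less.prems(1) r2 P by auto
    have "ga * (e - i' + 1) + be \<le> al * P'" using less.IH[OF P'(2) P'(1) s' X'] by simp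
    then have "r * (ga * (e - i' + 1) + be) \<le> r * (al * P')" by (rule mult_le_mono2)
    then have 1: "ga * (r * (e - i' + 1)) + r * be \<le> al * P" by (simp add: P algebra_simps)
    have "i' \<le> e" by (simp add: i'_def e_def div_le_mono)
    then obtain d where d: "e = i' + d" using le_Suc_ex by blast
    have "Q + 1 \<le> r * (e - i' + 1)" using e i j by (simp add: d algebra_simps)
    then have "ga * (Q + 1) \<le> ga * (r * (e - i' + 1))" by (rule mult_le_mono2)
    moreover have "be \<le> r * be" using r2 by simp
    ultimately show ?thesis using 1 by linarith
  qed
qed

lemma repetition_bound:
  assumes "k + 2 \<le> n" "0 < p" "\<And>l. l < n \<Longrightarrow> w (i + l) = w (i + p + l)"
  obtains P Q where "ga * (Q + 1) + be \<le> al * P" "7 * P \<le> 3 * p + 2" "3 * n \<le> 8 * Q + 12 + 3 * k"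
proof -
  obtain q P Q where *: "T (q + P) = T q + p" "0 < P" "s q = s (q + P)"
    "\<And>l. l < Q \<Longrightarrow> X (q + l) = X (q + P + l)" "3 * n \<le> 8 * Q + 12 + 3 * k"
    by (rule repetition_kernel[OF assms]) blast+
  have "7 * P \<le> 3 * p + 2" using T_bounds[of P q] *(1) by simp
  then show ?thesis using that kernel_bound[OF *(2,3,4)] *(5) by blast
qed

end

section \<open>From the encoding to rankings\<close>

definition start :: "(nat \<Rightarrow> bool) \<Rightarrow> nat \<Rightarrow> nat" where
  "start X q = (\<Sum>l<q. block_len (X l))"

primrec state :: "(nat \<Rightarrow> bool) \<Rightarrow> 'a list \<Rightarrow> nat \<Rightarrow> 'a list" where
  "state X c 0 = c"
| "state X c (Suc q) = step (X q) (state X c q)"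

lemma length_step [simp]: "length (step b l) = length l"
  by (cases "(b, l)" rule: step.cases) auto

lemma set_step [simp]: "set (step b l) = set l"
  by (cases "(b, l)" rule: step.cases) auto

lemma distinct_step [simp]: "distinct (step b l) = distinct l"
  by (cases "(b, l)" rule: step.cases) auto

lemma init_len_eq:
  assumes "stake (k - 1) w = [1..<k]"
  shows "init_len k w = k - 1"
  unfolding init_len_def
proof (rule Least_equality)
  show "card (set (stake (k - 1) w)) = k - 1" by (simp only: assms) simp
  show "k - 1 \<le> m" if "card (set (stake m w)) = k - 1" for m
    using card_length[of "stake m w"] that by simp
qed

text \<open>The next letter and the \<open>k - 3\<close> letters before it form a factor of length
  \<open>k - 2\<close>, which has distinct letters; so its rank is at most 3. Distinctness of the
  ranking makes the \<open>THE\<close> in \<open>encoding\<close> well defined.\<close>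

lemma encoded_letter:
  assumes k: "4 \<le> k" and wk: "sset w \<subseteq> {1..k}" and pre: "stake (k - 1) w = [1..<k]"
    and enc: "encodable k w"
    and suf: "drop 2 (ranking k (stake (k - 1 + i) w)) = stake (k - 2) (sdrop (Suc i) w)"
  shows "encoding k w !! i \<in> {1, 2, 3} \<and>
    w !! (k - 1 + i) = ranking k (stake (k - 1 + i) w) ! (encoding k w !! i - 1)"
proof -
  define R where "R = ranking k (stake (k - 1 + i) w)"
  define a where "a = w !! (k - 1 + i)"
  have lR: "length R = k" and dR: "distinct R" and sR: "set R = {1..k}"
    by (auto simp: R_def ranking_def)
  obtain c0 c1 c2 l where R: "R = c0 # c1 # c2 # l"
    using three_heads[of R] lR k by auto
  have "stake (k - 2) (sdrop (Suc (Suc i)) w) \<in> factors w"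
    unfolding factors_def by blast
  then have "distinct (stake (k - 2) (sdrop (Suc (Suc i)) w))"
    using enc by (auto simp: encodable_def card_distinct)
  moreover have "k - 2 = Suc (k - 3)" using k by simp
  then have "stake (k - 2) (sdrop (Suc (Suc i)) w) =
      stake (k - 3) (sdrop (Suc (Suc i)) w) @ [sdrop (Suc (Suc i)) w !! (k - 3)]"
    by (metis stake_Suc)
  moreover have "sdrop (Suc (Suc i)) w !! (k - 3) = a"
    unfolding sdrop_snth a_def using k by (intro arg_cong[where f = "snth w"]) simp
  moreover have "l = stake (k - 3) (sdrop (Suc (Suc i)) w)"
  proof -
    have "l = drop 1 (drop 2 R)" by (simp add: R)
    also have "\<dots> = drop 1 (stake (k - 2) (sdrop (Suc i) w))" using suf by (simp add: R_def)
    also have "\<dots> = stake (k - 3) (sdrop (Suc (Suc i)) w)"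
      using k by (simp add: drop_stake numeral_3_eq_3 numeral_2_eq_2)
    finally show ?thesis .
  qed
  ultimately have "a \<notin> set l" by auto
  moreover have "a \<in> set R" using wk snth_sset unfolding sR a_def by blast
  ultimately have "\<exists>j \<in> {1, 2, 3}. a = R ! (j - 1)" by (auto simp: R)
  then obtain j where j: "j \<in> {1, 2, 3}" "a = R ! (j - 1)" by blast
  have "(THE j. j \<in> {1, 2, 3} \<and> a = R ! (j - 1)) = j"
    using j dR by (intro the_equality) (auto simp: R)
  then have "encoding k w !! i = j"
    by (simp add: encoding_def init_len_eq[OF pre] a_def R_def)
  then show ?thesis using j by (simp add: a_def R_def)
qed

lemma encoded_ranking:
  assumes k: "4 \<le> k" and wk: "sset w \<subseteq> {1..k}" and pre: "stake (k - 1) w = [1..<k]"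
    and enc: "encodable k w"
  defines "R i \<equiv> ranking k (stake (k - 1 + i) w)"
  shows "w !! (k - 1 + i) = R i ! (encoding k w !! i - 1)"
    and "R (Suc i) = remove1 (w !! (k - 1 + i)) (R i) @ [w !! (k - 1 + i)]"
proof -
  have wi: "w !! n \<in> {1..k}" for n using wk snth_sset by blast
  have lR: "length (R i) = k" and dR: "distinct (R i)" for i
    by (auto simp: R_def ranking_def)
  have R0: "R 0 = k # [1..<k]" unfolding R_def using pre ranking_upt(1)[of k] k by simp
  have step: "inj_on (last_pos (stake (k - 1 + Suc i) w)) {1..k} \<and>
      R (Suc i) = remove1 (w !! (k - 1 + i)) (R i) @ [w !! (k - 1 + i)]"
    if "inj_on (last_pos (stake (k - 1 + i) w)) {1..k}" for i
    using ranking_snoc[OF that wi[of "k - 1 + i"]] unfolding R_def add_Suc_right stake_Suc by simp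
  \<comment> \<open>Injectivity of \<open>last_pos\<close> says that the ranking has no ties, as
    \<open>ranking_snoc\<close> requires; the suffix statement is what \<open>encoded_letter\<close>
    requires.\<close>
  have inv: "inj_on (last_pos (stake (k - 1 + i) w)) {1..k} \<and>
      drop 2 (R i) = stake (k - 2) (sdrop (Suc i) w)" for i
  proof (induction i)
    case 0
    have "drop 2 (R 0) = drop 1 (stake (k - 1) w)" using pre by (simp add: R0)
    also have "\<dots> = stake (k - 2) (sdrop (Suc 0) w)" by (simp add: drop_stake numeral_2_eq_2)
    finally show ?case using pre ranking_upt(2)[of k] k by simp
  next
    case (Suc i)
    define a where "a = w !! (k - 1 + i)"
    obtain c0 c1 c2 l where R: "R i = c0 # c1 # c2 # l"
      using three_heads[of "R i"] lR[of i] k by auto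
    have "encoding k w !! i \<in> {1, 2, 3}" "a = R i ! (encoding k w !! i - 1)"
      using encoded_letter[OF k wk pre enc] Suc unfolding a_def R_def by blast+
    then have "a \<in> {c0, c1, c2}" by (auto simp: R)
    moreover have "R (Suc i) = remove1 a (R i) @ [a]" using step Suc unfolding a_def by blast
    moreover have "distinct (c0 # c1 # c2 # l)" using dR[of i] by (simp only: R)
    ultimately have "drop 2 (R (Suc i)) = drop 1 (drop 2 (R i)) @ [a]" by (auto simp: R)
    also have "\<dots> = drop 1 (stake (k - 2) (sdrop (Suc i) w) @ [sdrop (Suc i) w !! (k - 2)])"
    proof -
      have "sdrop (Suc i) w !! (k - 2) = a"
        unfolding sdrop_snth a_def using k by (intro arg_cong[where f = "snth w"]) simp
      then show ?thesis using Suc k by simp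
    qed
    also have "\<dots> = drop 1 (stake (Suc (k - 2)) (sdrop (Suc i) w))" by (simp only: stake_Suc)
    also have "\<dots> = stake (k - 2) (sdrop (Suc (Suc i)) w)" by (simp add: drop_stake)
    finally show ?case using step[of i] Suc by blast
  qed
  show "w !! (k - 1 + i) = R i ! (encoding k w !! i - 1)"
    using encoded_letter[OF k wk pre enc, of i] inv[of i] unfolding R_def by blast
  show "R (Suc i) = remove1 (w !! (k - 1 + i)) (R i) @ [w !! (k - 1 + i)]"
    using step inv by blast
qed

lemma length_g: "x \<in> {1, 2} \<Longrightarrow> length (g x) = block_len (x = 2)"
  by (auto simp: g_def block_len_def)

lemma sdrop_smorph_g:
  assumes "sset x \<subseteq> {1, 2}"
  shows "sdrop (start (\<lambda>q. x !! q = 2) q) (smorph g x) = smorph g (sdrop q x)"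
proof (induction q)
  case 0 show ?case by (simp add: start_def)
next
  case (Suc q)
  have x: "x !! q \<in> {1, 2}" using assms by (auto simp: sset_range)
  have "sdrop q x = x !! q ## sdrop (Suc q) x" by (metis sdrop_simps stream.collapse)
  moreover have "g (x !! q) \<noteq> []" using x by (auto simp: g_def)
  ultimately have "smorph g (sdrop q x) = g (x !! q) @- smorph g (sdrop (Suc q) x)"
    by (simp add: smorph_def)
  then have "sdrop (length (g (x !! q))) (smorph g (sdrop q x)) = smorph g (sdrop (Suc q) x)"
    by (simp add: sdrop_shift)
  moreover have "start (\<lambda>q. x !! q = 2) (Suc q) = start (\<lambda>q. x !! q = 2) q + length (g (x !! q))"
    using x by (simp add: start_def length_g)
  ultimately show ?case using Suc by (metis sdrop_add)
qed

lemma smorph_g_start: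
  assumes "sset x \<subseteq> {1, 2}" "j < block_len (x !! q = 2)"
  shows "smorph g x !! (start (\<lambda>q. x !! q = 2) q + j) = g (x !! q) ! j"
proof -
  have x: "x !! q \<in> {1, 2}" using assms by (auto simp: sset_range)
  have "smorph g x !! (start (\<lambda>q. x !! q = 2) q + j) = smorph g (sdrop q x) !! j"
    using sdrop_smorph_g[OF assms(1), of q] by (metis sdrop_snth)
  also have "sdrop q x = x !! q ## sdrop (Suc q) x" by (metis sdrop_simps stream.collapse)
  also have "smorph g \<dots> = g (x !! q) @- smorph g (sdrop (Suc q) x)"
    using x by (auto simp: smorph_def g_def)
  also have "\<dots> !! j = g (x !! q) ! j"
    using assms(2) length_g[OF x] by simp
  finally show ?thesis .
qed

text \<open>The two or three code letters of a block together act as one \<open>step\<close>. The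
  initial ranking \<open>c\<close> has the missing letter \<open>k\<close> in front.\<close>

lemma encoded_state:
  assumes k: "4 \<le> k" and wk: "sset w \<subseteq> {1..k}" and pre: "stake (k - 1) w = [1..<k]"
    and enc: "encodable k w" and t: "encoding k w = smorph g x" and x: "sset x \<subseteq> {1, 2}"
  defines "X q \<equiv> x !! q = 2"
  defines "c \<equiv> k # [1..<k]"
  shows "ranking k (stake (k - 1 + start X q) w) = state X c q"
    and "stake (k - 1) (sdrop (start X q) w) = tl (state X c q)"
proof -
  define R where "R i = ranking k (stake (k - 1 + i) w)" for i
  note R = encoded_ranking[OF k wk pre enc, folded R_def]
  have "R (start X q) = state X c q \<and> stake (k - 1) (sdrop (start X q) w) = tl (state X c q)"
  proof (induction q)
    case 0
    show ?case using pre ranking_upt(1)[of k] k by (simp add: start_def R_def c_def)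
  next
    case (Suc q)
    define i where "i = start X q"
    have xq: "x !! q \<in> {1, 2}" using x by (auto simp: sset_range)
    have len: "length (state X c q) = k" "distinct (state X c q)" for q
      using k by (induction q) (auto simp: c_def)
    obtain a b c' d l where s: "state X c q = a # b # c' # d # l"
      using four_heads[of "state X c q"] len(1)[of q] k by auto
    have dist: "distinct (a # b # c' # d # l)" using len(2)[of q] by (simp add: s)
    have IH: "R i = a # b # c' # d # l" "stake (k - 1) (sdrop i w) = b # c' # d # l"
      using Suc by (simp_all add: s i_def)
    have t': "encoding k w !! (i + j) = g (x !! q) ! j" if "j < block_len (X q)" for j
      using smorph_g_start[OF x that[unfolded X_def]] unfolding t i_def X_def .
    have i1: "encoding k w !! i = 3" "encoding k w !! Suc i = 1"
      using t'[of 0] t'[of 1] xq by (auto simp: block_len_def g_def)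
    have w1: "w !! (k - 1 + i) = c'" using R(1)[of i] by (simp add: i1 IH)
    then have R1: "R (Suc i) = a # b # d # l @ [c']" using R(2)[of i] dist by (auto simp: IH)
    have w2: "w !! (k - 1 + Suc i) = a"
      using R(1)[of "Suc i"] by (simp add: i1 R1 del: snth.simps)
    then have R2: "R (Suc (Suc i)) = b # d # l @ [c', a]"
      using R(2)[of "Suc i"] dist by (auto simp: R1)
    have st: "stake (k - 1 + n) (sdrop i w) =
        b # c' # d # l @ stake n (sdrop (k - 1 + i) w)" for n
      using IH(2) stake_add[of "k - 1" "sdrop i w" n] by (simp add: add.commute flip: sdrop_add)
    show ?case
    proof (cases "X q")
      case False
      then have i': "start X (Suc q) = i + 2" by (simp add: start_def i_def block_len_def)
      have "stake 2 (sdrop (k - 1 + i) w) = [c', a]"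
        using w1 w2 by (simp add: numeral_2_eq_2 sdrop_snth flip: stake_Suc) 
      then have "drop 2 (stake (k - 1 + 2) (sdrop i w)) = d # l @ [c', a]"
        unfolding st by simp
      then have "stake (k - 1) (sdrop (i + 2) w) = d # l @ [c', a]"
        by (simp add: drop_stake sdrop_add)
      then show ?thesis using R2 False by (simp add: i' s)
    next
      case True
      then have i': "start X (Suc q) = i + 3" by (simp add: start_def i_def block_len_def)
      have i2: "encoding k w !! (Suc (Suc i)) = 2"
        using t'[of 2] True by (simp add: X_def block_len_def g_def)
      have w3: "w !! (k - 1 + Suc (Suc i)) = d"
        using R(1)[of "Suc (Suc i)"] by (simp add: i2 R2 del: snth.simps)
      then have R3: "R (Suc (Suc (Suc i))) = b # l @ [c', a, d]"
        using R(2)[of "Suc (Suc i)"] dist by (auto simp: R2)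
      have "stake 3 (sdrop (k - 1 + i) w) = [c', a, d]"
        using w1 w2 w3 by (simp add: numeral_3_eq_3 sdrop_snth flip: stake_Suc)
      then have "drop 3 (stake (k - 1 + 3) (sdrop i w)) = l @ [c', a, d]"
        unfolding st by simp
      then have "stake (k - 1) (sdrop (i + 3) w) = l @ [c', a, d]"
        by (simp add: drop_stake sdrop_add)
      then show ?thesis using R3 True by (simp add: i' s numeral_3_eq_3)
    qed
  qed
  then show "ranking k (stake (k - 1 + start X q) w) = state X c q"
    and "stake (k - 1) (sdrop (start X q) w) = tl (state X c q)"
    by (simp_all add: R_def)
qed

section \<open>Finite searches\<close>

text \<open>
  The searches are evaluated by rewriting. Branching goes through auxiliary functions on \<open>bool\<close>
  because \<open>if\<close> would make the rewriter normalise its long list arguments again and again; for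
  the same reason lengths are unary, as lists of units.
\<close>

datatype (plugins only: code) letter =
  L0 | L1 | L2 | L3 | L4 | L5 | L6 | L7 | L8 | L9 | L10 | L11

fun tk :: "unit list \<Rightarrow> 'a list \<Rightarrow> 'a list" where
  "tk [] xs = []"
| "tk (n # ns) [] = []"
| "tk (n # ns) (x # xs) = x # tk ns xs"

fun match :: "unit list \<Rightarrow> 'a list \<Rightarrow> 'a list \<Rightarrow> bool"
  and match' :: "bool \<Rightarrow> unit list \<Rightarrow> 'a list \<Rightarrow> 'a list \<Rightarrow> bool" where
  "match [] xs ys = True"
| "match (n # ns) [] ys = False"
| "match (n # ns) (x # xs) [] = False"
| "match (n # ns) (x # xs) (y # ys) = match' (x = y) ns xs ys"
| "match' False ns xs ys = False"
| "match' True ns xs ys = match ns xs ys"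

fun avoid :: "unit list \<Rightarrow> 'a list \<Rightarrow> 'a list \<Rightarrow> bool"
  and avoid' :: "bool \<Rightarrow> unit list \<Rightarrow> 'a list \<Rightarrow> 'a list \<Rightarrow> bool" where
  "avoid n xs [] = True"
| "avoid n xs (y # ys) = avoid' (match n xs (y # ys)) n xs ys"
| "avoid' True n xs ys = False"
| "avoid' False n xs ys = avoid n xs ys"

text \<open>\<open>ms\<close> counts starting positions, and \<open>ls\<close> the letters after
  each of them at which the factor of length \<open>n\<close> must not start again.\<close>

fun avoid_rep :: "unit list \<Rightarrow> unit list \<Rightarrow> unit list \<Rightarrow> 'a list \<Rightarrow> bool" where
  "avoid_rep [] n ls xs = True"
| "avoid_rep (m # ms) n ls [] = True"
| "avoid_rep (m # ms) n ls (x # xs) = (avoid n (tk n (x # xs)) (tk ls xs) \<and> avoid_rep ms n ls xs)"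

text \<open>The accumulator \<open>ys\<close> holds the letters already passed, last one first, so
  the factor ending at \<open>x\<close> is read backwards from the head of
  \<open>x # ys\<close>.\<close>

fun avoid_rev :: "unit list \<Rightarrow> unit list \<Rightarrow> unit list \<Rightarrow> 'a list \<Rightarrow> 'a list \<Rightarrow> bool" where
  "avoid_rev [] n ls ys xs = True"
| "avoid_rev (m # ms) n ls ys [] = True"
| "avoid_rev (m # ms) n ls ys (x # xs) =
    (avoid n (tk n (x # ys)) (tk ls xs) \<and> avoid_rev ms n ls (x # ys) xs)"

text \<open>The test \<open>e\<close> is not applied to the initial ranking, which excludes distance
  0.\<close>

fun scan :: "('a list \<Rightarrow> bool list \<Rightarrow> bool) \<Rightarrow> 'a list \<Rightarrow> bool list \<Rightarrow> bool"
  and scan1 :: "('a list \<Rightarrow> bool list \<Rightarrow> bool) \<Rightarrow> 'a list \<Rightarrow> bool list \<Rightarrow> bool"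
  and scan2 :: "bool \<Rightarrow> ('a list \<Rightarrow> bool list \<Rightarrow> bool) \<Rightarrow> 'a list \<Rightarrow> bool list \<Rightarrow> bool" where
  "scan e s [] = True"
| "scan e s (x # u) = scan1 e (step x s) u"
| "scan1 e s u = scan2 (e s u) e s u"
| "scan2 True e s u = False"
| "scan2 False e s u = scan e s u"

fun eql :: "'a list \<Rightarrow> 'a list \<Rightarrow> bool" and eql' :: "bool \<Rightarrow> 'a list \<Rightarrow> 'a list \<Rightarrow> bool" where
  "eql [] [] = True"
| "eql [] (y # ys) = False"
| "eql (x # xs) [] = False"
| "eql (x # xs) (y # ys) = eql' (x = y) xs ys"
| "eql' False xs ys = False"
| "eql' True xs ys = eql xs ys"

fun periodic' :: "bool \<Rightarrow> unit list \<Rightarrow> bool list \<Rightarrow> bool list \<Rightarrow> bool" where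
  "periodic' False n v u = False"
| "periodic' True n v u = match n v u"

definition periodic :: "'a list \<Rightarrow> unit list \<Rightarrow> bool list \<Rightarrow> 'a list \<Rightarrow> bool list \<Rightarrow> bool" where
  "periodic c n v s u = periodic' (eql s c) n v u"

text \<open>Each position restarts from the same \<open>c\<close>: up to renaming letters every
  ranking is \<open>c\<close>, so only the blocks that follow matter.\<close>

fun avoid_kernel :: "unit list \<Rightarrow> unit list \<Rightarrow> unit list \<Rightarrow> 'a list \<Rightarrow> bool list \<Rightarrow> bool" where
  "avoid_kernel [] n ls c u = True"
| "avoid_kernel (m # ms) n ls c [] = True"
| "avoid_kernel (m # ms) n ls c (x # u) =
    (scan (periodic c n (tk n (x # u))) c (tk ls (x # u)) \<and> avoid_kernel ms n ls c u)"

fun mirror' :: "bool \<Rightarrow> 'a \<Rightarrow> 'a \<Rightarrow> 'a \<Rightarrow> 'a \<Rightarrow> bool" where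
  "mirror' False a b a' b' = False"
| "mirror' True a b a' b' = (a = b' \<and> b = a')"

fun mirror :: "'a list \<Rightarrow> 'a list \<Rightarrow> bool" where
  "mirror (a # b # c # l) (a' # b' # c' # l') = mirror' (c = c') a b a' b'"
| "mirror l l' = False"

fun mirror3' :: "bool \<Rightarrow> 'a list \<Rightarrow> 'a list \<Rightarrow> 'a list \<Rightarrow> bool list \<Rightarrow> bool" where
  "mirror3' True s1 s0 s (x # y # u) = (mirror s1 (step x s) \<and> mirror s0 (step y (step x s)))"
| "mirror3' b s1 s0 s u = False"

text \<open>A reversed repetition gives nested pairs of mirrored rankings. The search looks for
  three: \<open>s2\<close> is the inner left ranking, \<open>s0\<close> the outer one.\<close>

definition mirror3 :: "'a list \<Rightarrow> 'a list \<Rightarrow> 'a list \<Rightarrow> 'a list \<Rightarrow> bool list \<Rightarrow> bool" where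
  "mirror3 s2 s1 s0 s u = mirror3' (mirror s2 s) s1 s0 s u"

fun avoid_mirror1 :: "'a list \<Rightarrow> 'a list \<Rightarrow> 'a list \<Rightarrow> bool list \<Rightarrow> bool" where
  "avoid_mirror1 s2 s1 s0 u = scan (mirror3 s2 s1 s0) s2 u"

fun avoid_mirror :: "unit list \<Rightarrow> unit list \<Rightarrow> 'a list \<Rightarrow> bool list \<Rightarrow> bool" where
  "avoid_mirror (m # ms) ls c (x # y # u) =
    (avoid_mirror1 (step y (step x c)) (step x c) c (tk ls u) \<and> avoid_mirror ms ls c (y # u))"
| "avoid_mirror ms ls c u = True"

text \<open>This is the factor of \<open>w\<close> produced from the ranking \<open>s\<close> by the
  blocks \<open>u\<close>. The first clause appends the final window, so the factor reaches
  \<open>k - 1\<close> letters past the last block start.\<close>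

fun letters :: "'a list \<Rightarrow> bool list \<Rightarrow> 'a list" where
  "letters (a # s) [] = s"
| "letters (a # b # c # s) (False # u) = b # c # letters (step False (a # b # c # s)) u"
| "letters (a # b # c # d # s) (True # u) = b # c # d # letters (step True (a # b # c # d # s)) u"
| "letters s u = []"

fun steps :: "bool list \<Rightarrow> 'a list \<Rightarrow> 'a list" where
  "steps [] s = s"
| "steps (x # u) s = steps u (step x s)"

lemma steps_append: "steps (u @ v) s = steps v (steps u s)"
  by (induction u arbitrary: s) auto

lemma steps_props [simp]:
  "length (steps u s) = length s" "set (steps u s) = set s" "distinct (steps u s) = distinct s"
  by (induction u arbitrary: s) auto

text \<open>\<open>step\<close> only moves positions. This is why a single ranking can stand for all
  of them in the searches.\<close>

lemma map_step: "map \<pi> (step b l) = step b (map \<pi> l)"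
  by (cases "(b, l)" rule: step.cases) auto

lemma map_steps: "map \<pi> (steps u l) = steps u (map \<pi> l)"
  by (induction u arbitrary: l) (auto simp: map_step)

lemma tk_take: "tk n xs = take (length n) xs"
  by (induction n xs rule: tk.induct) auto

lemma match'_simp: "match' b ns xs ys \<longleftrightarrow> b \<and> match ns xs ys"
  by (cases b) auto

lemma match_iff: "match n xs ys \<longleftrightarrow>
    length n \<le> length xs \<and> length n \<le> length ys \<and> (\<forall>l<length n. xs ! l = ys ! l)"
proof (induction n arbitrary: xs ys)
  case (Cons a n)
  then show ?case
    by (cases xs; cases ys) (auto simp: match'_simp less_Suc_eq_0_disj)
qed simp

lemma avoid'_simp: "avoid' b n xs ys \<longleftrightarrow> \<not> b \<and> avoid n xs ys"
  by (cases b) auto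

lemma avoidD: "avoid n xs ys \<Longrightarrow> d < length ys \<Longrightarrow> \<not> match n xs (drop d ys)"
proof (induction ys arbitrary: d)
  case (Cons y ys) then show ?case by (cases d) (auto simp: avoid'_simp)
qed simp

lemma avoid_repD:
  "avoid_rep ms n ls v \<Longrightarrow> i < length ms \<Longrightarrow> i < length v \<Longrightarrow>
    avoid n (take (length n) (drop i v)) (take (length ls) (drop (Suc i) v))"
proof (induction ms n ls v arbitrary: i rule: avoid_rep.induct)
  case (3 m ms n ls x xs) then show ?case by (cases i) (auto simp: tk_take)
qed auto

lemma avoid_revD:
  "avoid_rev ms n ls ys v \<Longrightarrow> i < length ms \<Longrightarrow> i < length v \<Longrightarrow>
    avoid n (take (length n) (rev (take (Suc i) v) @ ys)) (take (length ls) (drop (Suc i) v))"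
proof (induction ms n ls ys v arbitrary: i rule: avoid_rev.induct)
  case (3 m ms n ls ys x xs) then show ?case by (cases i) (auto simp: tk_take)
qed auto

lemma scan2_simp: "scan2 b e s u \<longleftrightarrow> \<not> b \<and> scan e s u"
  by (cases b) auto

lemma scanD:
  "scan e s u \<Longrightarrow> 0 < P \<Longrightarrow> P \<le> length u \<Longrightarrow> \<not> e (steps (take P u) s) (drop P u)"
proof (induction u arbitrary: s P)
  case (Cons x u)
  then obtain P' where P: "P = Suc P'" by (cases P) auto
  show ?case
  proof (cases P')
    case 0 then show ?thesis using Cons.prems by (simp add: P scan2_simp)
  next
    case (Suc P'') then show ?thesis using Cons by (simp add: P scan2_simp)
  qed
qed simp

lemma eql'_simp: "eql' b xs ys \<longleftrightarrow> b \<and> eql xs ys"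
  by (cases b) auto

lemma eql_iff: "eql xs ys \<longleftrightarrow> xs = ys"
proof (induction xs arbitrary: ys)
  case Nil show ?case by (cases ys) auto
next
  case (Cons x xs) then show ?case by (cases ys) (auto simp: eql'_simp)
qed

lemma periodic_iff: "periodic c n v s u \<longleftrightarrow> s = c \<and> match n v u"
  by (cases "s = c") (auto simp: periodic_def eql_iff)

lemma avoid_kernelD:
  "avoid_kernel ms n ls c u \<Longrightarrow> i < length ms \<Longrightarrow> i < length u \<Longrightarrow>
    scan (periodic c n (take (length n) (drop i u))) c (take (length ls) (drop i u))"
proof (induction ms n ls c u arbitrary: i rule: avoid_kernel.induct)
  case (3 m ms n ls c x u) then show ?case by (cases i) (auto simp: tk_take)
qed auto

lemma mirror_iff: "3 \<le> length s \<Longrightarrow> 3 \<le> length s' \<Longrightarrow> mirror s s' \<longleftrightarrow> mirrored s s'"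
proof -
  assume "3 \<le> length s" "3 \<le> length s'"
  then obtain a b c l a' b' c' l' where "s = a # b # c # l" "s' = a' # b' # c' # l'"
    using three_heads by metis
  then show ?thesis by (cases "c = c'") (auto simp: mirrored_def)
qed

lemma avoid_mirrorD:
  "avoid_mirror ms ls c u \<Longrightarrow> i < length ms \<Longrightarrow> i + 2 \<le> length u \<Longrightarrow>
    scan (mirror3 (steps (take 2 (drop i u)) c) (steps (take 1 (drop i u)) c) c)
      (steps (take 2 (drop i u)) c) (take (length ls) (drop (i + 2) u))"
proof (induction ms ls c u arbitrary: i rule: avoid_mirror.induct)
  case (1 m ms ls c x y u)
  then show ?case by (cases i) (auto simp: tk_take numeral_2_eq_2)
qed (auto)

lemma letters_map: "letters (map \<pi> s) u = map \<pi> (letters s u)"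
proof (induction s u rule: letters.induct)
  case (2 a b c s u) then show ?case by (cases s) (auto simp: map_step)
next
  case (3 a b c d s u) then show ?case by (auto simp: map_step)
qed auto

lemma set_letters: "set (letters s u) \<subseteq> set s"
proof (induction s u rule: letters.induct)
  case (2 a b c s u) then show ?case using set_step[of False "a # b # c # s"] by auto
next
  case (3 a b c d s u) then show ?case using set_step[of True "a # b # c # d # s"] by auto
qed auto

lemma ex_renaming:
  assumes "length s = length c" "distinct s" "distinct c"
  obtains \<pi> where "s = map \<pi> c" "inj_on \<pi> (set c)"
proof -
  define \<pi> where "\<pi> = (\<lambda>a. the (map_of (zip c s) a))"
  have s: "s = map \<pi> c"
    using assms by (auto intro!: nth_equalityI simp: \<pi>_def map_of_zip_nth)
  moreover have "inj_on \<pi> (set c)" using assms(2) unfolding s by (simp add: distinct_map)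
  ultimately show ?thesis using that by blast
qed

section \<open>Fixed points of uniform morphisms\<close>

definition fixed_point :: "(bool \<Rightarrow> bool list) \<Rightarrow> nat \<Rightarrow> (nat \<Rightarrow> bool) \<Rightarrow> bool" where
  "fixed_point h r X \<longleftrightarrow> 0 < r \<and> (\<forall>b. length (h b) = r) \<and> (\<forall>m j. j < r \<longrightarrow> X (r * m + j) = h (X m) ! j)"

lemma nth_concat_uniform:
  assumes "\<And>b. length (h b) = r" "0 < r" "j < r * length u"
  shows "concat (map h u) ! j = h (u ! (j div r)) ! (j mod r)"
  using assms(3)
proof (induction u arbitrary: j)
  case (Cons b u)
  show ?case
  proof (cases "j < r")
    case True then show ?thesis using assms(1,2) by (simp add: nth_append)
  next
    case False
    then have "concat (map h (b # u)) ! j = concat (map h u) ! (j - r)"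
      using assms(1) by (simp add: nth_append)
    also have "\<dots> = h (u ! ((j - r) div r)) ! ((j - r) mod r)" using Cons False by auto
    also have "(j - r) mod r = j mod r" using False by (simp add: le_mod_geq)
    finally show ?thesis using False assms(2) by (simp add: le_div_geq)
  qed
qed simp

lemma length_concat_uniform:
  "(\<And>b. length (h b) = r) \<Longrightarrow> length (concat (map h u)) = r * length u"
  by (induction u) auto

lemma fixed_point_window:
  assumes "fixed_point h r X" "j < r * l"
  shows "concat (map h (map X [m..<m + l])) ! j = X (r * m + j)"
proof -
  have h: "0 < r" "\<And>b. length (h b) = r" "\<And>m j. j < r \<Longrightarrow> X (r * m + j) = h (X m) ! j"
    using assms(1) by (auto simp: fixed_point_def)
  have jr: "j div r < l" using assms(2) h(1) by (simp add: less_mult_imp_div_less mult.commute)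
  have "X (r * m + j) = X (r * (m + j div r) + j mod r)"
    by (simp add: algebra_simps)
  then show ?thesis
    using h jr assms(2) by (subst nth_concat_uniform[where r = r]) auto
qed

lemma fixed_point_comp:
  assumes "fixed_point h r X" "fixed_point h' r' X"
  shows "fixed_point (\<lambda>b. concat (map h (h' b))) (r * r') X"
  unfolding fixed_point_def
proof (intro conjI allI impI)
  have h: "0 < r" "\<And>b. length (h b) = r" "\<And>m j. j < r \<Longrightarrow> X (r * m + j) = h (X m) ! j"
    and h': "0 < r'" "\<And>b. length (h' b) = r'" "\<And>m j. j < r' \<Longrightarrow> X (r' * m + j) = h' (X m) ! j"
    using assms by (auto simp: fixed_point_def)
  show "0 < r * r'" using h h' by simp
  show "length (concat (map h (h' b))) = r * r'" for b
    by (simp add: length_concat_uniform[OF h(2)] h')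
  show "X (r * r' * m + j) = concat (map h (h' (X m))) ! j" if j: "j < r * r'" for m j
  proof -
    have jr: "j div r < r'" using j h(1) by (simp add: less_mult_imp_div_less mult.commute)
    have "X (r * r' * m + j) = X (r * (r' * m + j div r) + j mod r)"
      by (simp add: algebra_simps)
    also have "\<dots> = h (h' (X m) ! (j div r)) ! (j mod r)" using h h' jr by simp
    finally show ?thesis using nth_concat_uniform[OF h(2,1), of j "h' (X m)"] j h'(2) by simp
  qed
qed

lemma fixed_point_pair:
  assumes "fixed_point h r X" "j < 2 * r"
  shows "(h (X m) @ h (X (Suc m))) ! j = X (r * m + j)"
  using fixed_point_window[OF assms(1), of j 2 m] assms(2)
  by (simp add: mult.commute numeral_2_eq_2)

text \<open>A factor that starts in one image and ends no later than the next is determined by two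
  letters of \<open>X\<close> and an offset, so testing all pairs of letters covers it.\<close>

lemma fixed_point_factor:
  assumes "fixed_point h r X"
  obtains m j where "i = r * m + j" "j < r"
    "\<And>n. j + n \<le> 2 * r \<Longrightarrow> map X [i..<i + n] = take n (drop j (h (X m) @ h (X (Suc m))))"
proof -
  have r: "0 < r" and len: "\<And>b. length (h b) = r" using assms by (auto simp: fixed_point_def)
  show ?thesis
  proof (rule that[of "i div r" "i mod r"])
    fix n assume n: "i mod r + n \<le> 2 * r"
    show "map X [i..<i + n] = take n (drop (i mod r) (h (X (i div r)) @ h (X (Suc (i div r)))))"
    proof (rule nth_equalityI)
      show "length (map X [i..<i + n]) =
          length (take n (drop (i mod r) (h (X (i div r)) @ h (X (Suc (i div r))))))"
        using n by (simp only: length_map length_upt length_take length_drop length_append len)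
      fix l assume "l < length (map X [i..<i + n])"
      then have l: "l < n" by simp
      have "(h (X (i div r)) @ h (X (Suc (i div r)))) ! (i mod r + l) =
          X (r * (i div r) + (i mod r + l))"
        using n l by (intro fixed_point_pair[OF assms]) simp
      then show "map X [i..<i + n] ! l =
          take n (drop (i mod r) (h (X (i div r)) @ h (X (Suc (i div r))))) ! l"
        using l n by (simp add: len add.assoc[symmetric] del: take_append drop_append)
    qed
  qed (use r in simp_all)
qed

section \<open>Soundness of the searches\<close>

context coded_word
begin

lemma s_add: "s (q + m) = steps (map X [q..<q + m]) (s q)"
  by (induction m) (auto simp: steps_append s_Suc)

lemma renaming:
  assumes "length c = k" "distinct c"
  obtains \<pi> where "s q = map \<pi> c" "inj_on \<pi> (set c)"
    "\<And>m. s (q + m) = map \<pi> (steps (map X [q..<q + m]) c)"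
proof -
  obtain \<pi> where \<pi>: "s q = map \<pi> c" "inj_on \<pi> (set c)"
    using ex_renaming[of "s q" c] assms len_s dist_s by metis
  moreover have "s (q + m) = map \<pi> (steps (map X [q..<q + m]) c)" for m
    by (simp only: s_add map_steps \<pi>(1))
  ultimately show ?thesis using that by blast
qed

lemma kernel_avoided:
  assumes h: "fixed_point h r X" and c: "length c = k" "distinct c"
    and chk: "\<And>a b. avoid_kernel ms n ls c (h a @ h b)"
    and ms: "r \<le> length ms" and ls: "length ls \<le> r"
    and P: "0 < P" "P + length n \<le> length ls"
    and rep: "s i = s (i + P)" "\<And>l. l < length n \<Longrightarrow> X (i + l) = X (i + P + l)"
  shows False
proof -
  obtain m j where i: "i = r * m + j" "j < r" and
    fac: "\<And>n. j + n \<le> 2 * r \<Longrightarrow> map X [i..<i + n] = take n (drop j (h (X m) @ h (X (Suc m))))"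
    using fixed_point_factor[OF h, of i] by metis
  define u where "u = h (X m) @ h (X (Suc m))"
  have lu: "length u = 2 * r" using h by (simp add: u_def fixed_point_def)
  have u: "u ! (j + l) = X (i + l)" if "j + l < 2 * r" for l
    using fixed_point_pair[OF h that, of m] i by (simp add: u_def add.assoc)
  obtain \<pi> where \<pi>: "s i = map \<pi> c" "inj_on \<pi> (set c)"
    "\<And>m. s (i + m) = map \<pi> (steps (map X [i..<i + m]) c)"
    using renaming[OF c, of i] by metis
  \<comment> \<open>The renaming is injective on \<open>c\<close>, so equal rankings at
    \<open>i\<close> and \<open>i + P\<close> mean that the search starting from \<open>c\<close>
    returns to \<open>c\<close>.\<close>
  have "map \<pi> (steps (take P (drop j u)) c) = map \<pi> c"
    using \<pi>(1) \<pi>(3)[of P] rep(1) fac[of P] P i ls by (simp add: u_def)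
  then have "steps (take P (drop j u)) c = c"
    using map_inj_on \<pi>(2) steps_props(2) by (metis Un_absorb)
  moreover have "scan (periodic c n (take (length n) (drop j u))) c (take (length ls) (drop j u))"
    unfolding u_def by (rule avoid_kernelD[OF chk]) (use i ms lu in \<open>auto simp: u_def\<close>)
  then have "\<not> periodic c n (take (length n) (drop j u))
      (steps (take P (take (length ls) (drop j u))) c) (drop P (take (length ls) (drop j u)))"
    by (rule scanD) (use P ls i lu in auto)
  moreover have "match n (take (length n) (drop j u)) (drop P (take (length ls) (drop j u)))"
    unfolding match_iff
  proof (intro conjI allI impI)
    fix l assume l: "l < length n"
    then show "take (length n) (drop j u) ! l = drop P (take (length ls) (drop j u)) ! l"
      using rep(2)[OF l] u[of l] u[of "P + l"] P i ls lu by (simp add: add.assoc)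
  qed (use P ls i lu in auto)
  ultimately show False using P by (simp add: periodic_iff min_absorb1)
qed

text \<open>The three pairs lie at distances \<open>D\<close>, \<open>D + 2\<close>,
  \<open>D + 4\<close>, with left members \<open>i + 2\<close>, \<open>i + 1\<close>,
  \<open>i\<close>. The search walks forward from \<open>i\<close>, remembers three rankings, and
  looks for the right members.\<close>

lemma mirror_avoided:
  assumes h: "fixed_point h r X" and c: "length c = k" "distinct c"
    and chk: "\<And>a b. avoid_mirror ms ls c (h a @ h b)"
    and ms: "r \<le> length ms" and ls: "length ls + 2 \<le> r"
    and D: "0 < D" "D + 2 \<le> length ls"
    and mir: "\<And>l. l \<le> 2 \<Longrightarrow> mirrored (s (i + 2 - l)) (s (i + 2 + D + l))"
  shows False
proof -
  obtain m j where i: "i = r * m + j" "j < r" and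
    fac: "\<And>n. j + n \<le> 2 * r \<Longrightarrow> map X [i..<i + n] = take n (drop j (h (X m) @ h (X (Suc m))))"
    using fixed_point_factor[OF h, of i] by metis
  define u where "u = h (X m) @ h (X (Suc m))"
  have lu: "length u = 2 * r" using h by (simp add: u_def fixed_point_def)
  obtain \<pi> where \<pi>: "s i = map \<pi> c" "inj_on \<pi> (set c)"
    "\<And>m. s (i + m) = map \<pi> (steps (map X [i..<i + m]) c)"
    using renaming[OF c, of i] by metis
  define t where "t n = steps (take n (drop j u)) c" for n
  have st: "s (i + n) = map \<pi> (t n)" if "n \<le> r" for n
    using \<pi>(3)[of n] fac[of n] that i by (simp add: t_def u_def)
  have tp: "set (t n) = set c" "length (t n) = k" for n using c by (simp_all add: t_def)
  have mt: "mirror (t a) (t b)" if "mirrored (s (i + a)) (s (i + b))" "a \<le> r" "b \<le> r" for a b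
  proof -
    have "t n ! l \<in> set c" if "l < k" for n l using that tp by (metis nth_mem)
    then have "mirrored (t a) (t b)"
      using that(1) \<pi>(2) k4 unfolding st[OF that(2)] st[OF that(3)] mirrored_def
      by (simp add: tp inj_on_eq_iff)
    then show ?thesis using mirror_iff[of "t a" "t b"] tp k4 by simp
  qed
  have "scan (mirror3 (t 2) (t 1) c) (t 2) (take (length ls) (drop (j + 2) u))"
    unfolding t_def u_def by (rule avoid_mirrorD[OF chk]) (use i ms ls lu D in \<open>auto simp: u_def\<close>)
  then have no: "\<not> mirror3 (t 2) (t 1) c (steps (take D (take (length ls) (drop (j + 2) u))) (t 2))
      (drop D (take (length ls) (drop (j + 2) u)))"
    by (rule scanD) (use D ls i lu in auto)
  have split: "take (a + b) (drop j u) = take a (drop j u) @ take b (drop (j + a) u)" for a b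
    by (simp add: take_add add.commute)
  have tD: "steps (take D (take (length ls) (drop (j + 2) u))) (t 2) = t (2 + D)"
    using D by (simp only: t_def split steps_append take_take min_absorb1)
  define v where "v = drop D (take (length ls) (drop (j + 2) u))"
  have lv: "2 \<le> length v" using D ls i lu by (simp add: v_def)
  then obtain x y v' where v: "v = x # y # v'"
    by (metis Suc_le_length_iff numeral_2_eq_2)
  have "take 2 v = take 2 (drop (j + (2 + D)) u)"
    using D by (simp add: v_def drop_take min_def add.commute add.left_commute)
  then have dv: "take 2 (drop (j + (2 + D)) u) = [x, y]" by (simp add: v numeral_2_eq_2)
  then have dv1: "take 1 (drop (j + (2 + D)) u) = [x]"
    by (metis One_nat_def take_Suc_Cons take0 take_take min.absorb1 one_le_numeral)
  have t3: "t (2 + D + 2) = step y (step x (t (2 + D)))" "t (2 + D + 1) = step x (t (2 + D))"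
    unfolding t_def split[of "2 + D"] steps_append dv dv1 by simp_all
  have "mirror (t 2) (t (2 + D))" "mirror (t 1) (t (2 + D + 1))" "mirror (t 0) (t (2 + D + 2))"
    using mir[of 0] mir[of 1] mir[of 2] D ls by (auto intro!: mt simp: add.assoc)
  moreover have "t 0 = c" by (simp add: t_def)
  ultimately have "mirror3 (t 2) (t 1) c (t (2 + D)) v"
    unfolding mirror3_def v t3 by simp
  then show False using no tD by (simp add: v_def)
qed

lemma letters_length: "length (letters (s q) (map X [q..<q + m])) = T (q + m) - T q + (k - 1)"
  and letters_nth: "l < T (q + m) - T q + (k - 1) \<Longrightarrow> letters (s q) (map X [q..<q + m]) ! l = w (T q + l)"
proof -
  have "length (letters (s q) (map X [q..<q + m])) = T (q + m) - T q + (k - 1) \<and>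
    (\<forall>l < T (q + m) - T q + (k - 1). letters (s q) (map X [q..<q + m]) ! l = w (T q + l))"
  proof (induction m arbitrary: q)
    case 0
    obtain a b c d l where "s q = a # b # c # d # l" "k = length l + 4" by (rule s_conv)
    then show ?case using w_T[of _ q] by (auto simp: less_Suc_eq_0_disj nth_Cons')
  next
    case (Suc m)
    obtain a b c d l where s: "s q = a # b # c # d # l" and k: "k = length l + 4" by (rule s_conv)
    have up: "map X [q..<q + Suc m] = X q # map X [Suc q..<Suc q + m]"
      by (simp add: upt_rec)
    define N where "N = T (Suc q + m) - T (Suc q)"
    define v where "v = letters (s (Suc q)) (map X [Suc q..<Suc q + m])"
    have IH: "length v = N + (k - 1)" "\<And>l. l < N + (k - 1) \<Longrightarrow> v ! l = w (T (Suc q) + l)"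
      using Suc.IH[of "Suc q"] by (auto simp: N_def v_def)
    have T: "T (Suc q + m) - T q = block_len (X q) + N"
      using T_le_iff[of "Suc q" "Suc q + m"] by (simp add: N_def T_Suc)
    have w: "w (T q) = b" "w (T q + 1) = c" "w (T q + 2) = d"
      using w_T[of 0 q] w_T[of 1 q] w_T[of 2 q] k by (simp_all add: s numeral_2_eq_2)
    have "letters (s q) (X q # map X [Suc q..<Suc q + m]) =
        (if X q then [b, c, d] else [b, c]) @ v"
      by (auto simp: s v_def s_Suc)
    moreover have "((if X q then [b, c, d] else [b, c]) @ v) ! l = w (T q + l)"
      if "l < block_len (X q) + N + (k - 1)" for l
    proof (cases "l < block_len (X q)")
      case True
      then have "l = 0 \<or> l = 1 \<or> l = 2 \<and> X q" by (auto simp: block_len_def split: if_splits)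
      then show ?thesis using w by auto
    next
      case False
      then have "((if X q then [b, c, d] else [b, c]) @ v) ! l = v ! (l - block_len (X q))"
        by (auto simp: nth_append block_len_def numeral_2_eq_2 numeral_3_eq_3)
      also have "\<dots> = w (T (Suc q) + (l - block_len (X q)))" using that False by (intro IH(2)) simp
      finally show ?thesis using False by (simp add: T_Suc)
    qed
    ultimately show ?case using IH(1) T unfolding up by (auto simp: block_len_def)
  qed
  then show "length (letters (s q) (map X [q..<q + m])) = T (q + m) - T q + (k - 1)"
    "l < T (q + m) - T q + (k - 1) \<Longrightarrow> letters (s q) (map X [q..<q + m]) ! l = w (T q + l)"
    by blast+
qed

text \<open>The position \<open>i\<close> falls in the first of \<open>l\<close> images, less than
  \<open>(8 * r + 2) / 3\<close> letters from its start. By \<open>T_bounds\<close> the other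
  \<open>l - 1\<close> images leave at least \<open>(7 * r * (l - 1) - 2) / 3\<close> letters from
  \<open>i\<close> on.\<close>

lemma letter_window:
  assumes h: "fixed_point h r X" and c: "length c = k" "distinct c" and l: "0 < l"
  obtains m \<pi> v where "v = letters c (concat (map h (map X [m..<m + l])))"
    "T (r * m) \<le> i" "3 * (i - T (r * m)) < 8 * r + 2" "inj_on \<pi> (set c)"
    "3 * (i - T (r * m)) + 7 * (r * (l - 1)) \<le> 3 * length v + 2"
    "\<And>j. j < length v \<Longrightarrow> w (T (r * m) + j) = \<pi> (v ! j)"
proof -
  have r: "0 < r" "\<And>b. length (h b) = r" using h by (auto simp: fixed_point_def)
  obtain q where q: "T q \<le> i" "i < T (Suc q)" by (rule T_greatest)
  define m where "m = q div r"
  have "r * m \<le> q" by (simp add: m_def)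
  have "q < r * Suc m" using r by (simp add: m_def dividend_less_times_div)
  then have b: "T (r * m) \<le> i" "i < T (r * m + r)"
    using q T_le_iff[of "r * m" q] T_le_iff[of "Suc q" "r * m + r"] \<open>r * m \<le> q\<close> by auto
  define v where "v = letters c (concat (map h (map X [m..<m + l])))"
  have u: "map X [r * m..<r * m + r * l] = concat (map h (map X [m..<m + l]))"
    using length_concat_uniform[of h r "map X [m..<m + l]"] r
    by (intro nth_equalityI) (auto simp: fixed_point_window[OF h] simp del: map_map)
  obtain \<pi> where \<pi>: "s (r * m) = map \<pi> c" "inj_on \<pi> (set c)"
    using renaming[OF c, of "r * m"] by metis
  have lv: "length v = T (r * m + r * l) - T (r * m) + (k - 1)"
    using letters_length[of "r * m" "r * l"] unfolding \<pi>(1) letters_map u v_def by simp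
  have rl: "r * m + r * l = r * m + r + r * (l - 1)" using l by (cases l) simp_all
  have tb: "3 * (T (r * m + r) - T (r * m)) \<le> 8 * r + 2"
    "7 * (r * (l - 1)) \<le> 3 * (T (r * m + r + r * (l - 1)) - T (r * m + r)) + 2"
    using T_bounds by blast+
  have mono: "T (r * m + r) \<le> T (r * m + r + r * (l - 1))" by (simp add: T_le_iff)
  show ?thesis
  proof (rule that[of v m \<pi>])
    show "3 * (i - T (r * m)) + 7 * (r * (l - 1)) \<le> 3 * length v + 2"
      using lv[unfolded rl] tb b mono by linarith
    show "w (T (r * m) + j) = \<pi> (v ! j)" if "j < length v" for j
      using letters_nth[of j "r * m" "r * l"] that lv unfolding \<pi>(1) letters_map u v_def
      by simp
  qed (use b tb \<pi> v_def in auto)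
qed

lemma repetition_avoided:
  assumes h: "fixed_point h r X" and c: "length c = k" "distinct c"
    and len: "0 < len"
    and chk: "\<And>m. avoid_rep ms n ls (letters c (concat (map h (map X [m..<m + len]))))"
    and ms: "8 * r + 2 \<le> 3 * length ms" and ls: "3 * length ls + 5 \<le> 7 * (r * (len - 1))"
    and p: "0 < length n" "0 < p" "p + length n \<le> Suc (length ls)"
    and rep: "\<And>l. l < length n \<Longrightarrow> w (i + l) = w (i + p + l)"
  shows False
proof -
  obtain m \<pi> v where v: "v = letters c (concat (map h (map X [m..<m + len])))"
    and m: "T (r * m) \<le> i" "3 * (i - T (r * m)) < 8 * r + 2" "inj_on \<pi> (set c)"
      "3 * (i - T (r * m)) + 7 * (r * (len - 1)) \<le> 3 * length v + 2"
      "\<And>j. j < length v \<Longrightarrow> w (T (r * m) + j) = \<pi> (v ! j)"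
    by (rule letter_window[OF h c, of len i]) (use len in simp, blast)
  define j where "j = i - T (r * m)"
  have i: "i = T (r * m) + j" using m(1) by (simp add: j_def)
  have j: "3 * j < 8 * r + 2" "3 * j + 7 * (r * (len - 1)) \<le> 3 * length v + 2"
    using m by (simp_all add: j_def)
  have vc: "v ! l \<in> set c" if "l < length v" for l
    using set_letters[of c] nth_mem[OF that] unfolding v by blast
  have eq: "v ! (j + l) = v ! (j + p + l)" if "l < length n" for l
  proof -
    have "w (T (r * m) + (j + l)) = w (T (r * m) + (j + p + l))"
      using rep[OF that] by (simp add: i add.assoc)
    moreover have "j + l < length v" "j + p + l < length v" using that p ls j by linarith+
    ultimately show ?thesis using m(3,5) vc by (metis inj_on_eq_iff)
  qed
  have "avoid n (take (length n) (drop j v)) (take (length ls) (drop (Suc j) v))"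
  proof (rule avoid_repD)
    show "avoid_rep ms n ls v" unfolding v by (rule chk)
  qed (use j ls ms p in linarith)+
  \<comment> \<open>The list searched begins one letter after \<open>j\<close>, so distance
    \<open>p\<close> corresponds to dropping \<open>p - 1\<close> letters.\<close>
  moreover have "p - 1 < length ls" "p - 1 < length v - Suc j" using p j ls by linarith+
  ultimately have "\<not> match n (take (length n) (drop j v)) (drop (p - 1) (take (length ls) (drop (Suc j) v)))"
    by (intro avoidD) simp_all
  moreover have "match n (take (length n) (drop j v)) (drop (p - 1) (take (length ls) (drop (Suc j) v)))"
    unfolding match_iff
  proof (intro conjI allI impI)
    fix l assume l: "l < length n"
    then show "take (length n) (drop j v) ! l = drop (p - 1) (take (length ls) (drop (Suc j) v)) ! l"
      using eq[OF l] p j ls by (simp add: algebra_simps)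
  qed (use j p ls in auto)
  ultimately show False by blast
qed

lemma reversal_avoided:
  assumes h: "fixed_point h r X" and c: "length c = k" "distinct c"
    and len: "0 < len"
    and chk: "\<And>m. avoid_rev ms n ls [] (letters c (concat (map h (map X [m..<m + len]))))"
    and ms: "8 * r + 2 + 3 * length n \<le> 3 * length ms"
    and ls: "3 * length ls + 3 * length n + 5 \<le> 7 * (r * (len - 1))"
    and n: "0 < length n"
    and d: "0 < d" "d + length n \<le> Suc (length ls)"
    and rev: "\<And>l. l < length n \<Longrightarrow> w (i + l) = w (i + length n - 1 + d + (length n - 1 - l))"
  shows False
proof -
  obtain m \<pi> v where v: "v = letters c (concat (map h (map X [m..<m + len])))"
    and m: "T (r * m) \<le> i" "3 * (i - T (r * m)) < 8 * r + 2" "inj_on \<pi> (set c)"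
      "3 * (i - T (r * m)) + 7 * (r * (len - 1)) \<le> 3 * length v + 2"
      "\<And>j. j < length v \<Longrightarrow> w (T (r * m) + j) = \<pi> (v ! j)"
    by (rule letter_window[OF h c, of len i]) (use len in simp, blast)
  \<comment> \<open>The last letter of the left factor: the search reads leftwards from
    \<open>I\<close> and rightwards from \<open>I + d\<close>.\<close>
  define I where "I = i - T (r * m) + length n - 1"
  have i: "i + length n = T (r * m) + Suc I" "length n \<le> Suc I"
    using m(1) n unfolding I_def by linarith+
  have j: "3 * I < 8 * r + 3 * length n"
    "3 * I + 7 * (r * (len - 1)) \<le> 3 * length v + 3 * length n"
    using m(1,2,4) n unfolding I_def by linarith+
  have vc: "v ! l \<in> set c" if "l < length v" for l
    using set_letters[of c] nth_mem[OF that] unfolding v by blast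
  have eq: "v ! (I - l) = v ! (I + d + l)" if "l < length n" for l
  proof -
    have "w (T (r * m) + (I - l)) = w (T (r * m) + (I + d + l))"
    proof -
      have "i + (length n - 1 - l) = T (r * m) + (I - l)" using i that by linarith
      moreover have "i + length n - 1 + d + (length n - 1 - (length n - 1 - l)) = T (r * m) + (I + d + l)"
        using i that by linarith
      ultimately show ?thesis using rev[of "length n - 1 - l"] that by simp
    qed
    moreover have "I - l < length v" "I + d + l < length v" using that d ls j i by linarith+
    ultimately show ?thesis using m(3,5) vc by (metis inj_on_eq_iff)
  qed
  have Iv: "I < length v" using j ls n by linarith
  have "avoid n (take (length n) (rev (take (Suc I) v) @ [])) (take (length ls) (drop (Suc I) v))"
  proof (rule avoid_revD)
    show "avoid_rev ms n ls [] v" unfolding v by (rule chk)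
  qed (use j ls ms Iv in linarith)+
  moreover have "d - 1 < length ls" "d - 1 < length v - Suc I" using d j ls n by linarith+
  ultimately have "\<not> match n (take (length n) (rev (take (Suc I) v)))
      (drop (d - 1) (take (length ls) (drop (Suc I) v)))"
    by (intro avoidD) simp_all
  moreover have "match n (take (length n) (rev (take (Suc I) v)))
      (drop (d - 1) (take (length ls) (drop (Suc I) v)))"
    unfolding match_iff
  proof (intro conjI allI impI)
    fix l assume l: "l < length n"
    then show "take (length n) (rev (take (Suc I) v)) ! l =
        drop (d - 1) (take (length ls) (drop (Suc I) v)) ! l"
      using eq[OF l] d j ls i Iv by (simp add: rev_nth algebra_simps)
  qed (use j d ls i Iv in auto)
  ultimately show False by blast
qed

end

section \<open>Factors of fixed points\<close>

definition factor_table :: "(bool \<Rightarrow> bool list) \<Rightarrow> nat \<Rightarrow> nat \<Rightarrow> (nat \<times> bool \<times> bool list) list" where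
  "factor_table f r n = concat (map (\<lambda>a. concat (map (\<lambda>b.
     map (\<lambda>i. (i, a, take n (drop i (f a @ f b)))) [0..<r]) [False, True])) [False, True])"

lemma concat_mapI: "a \<in> set xs \<Longrightarrow> y \<in> set (F a) \<Longrightarrow> y \<in> set (concat (map F xs))"
  by auto

lemma factor_tableI:
  assumes "fixed_point f r X" "n \<le> Suc r"
  shows "(i mod r, X (i div r), map X [i..<i + n]) \<in> set (factor_table f r n)"
proof -
  obtain m j where i: "i = r * m + j" "j < r" and
    fac: "\<And>n. j + n \<le> 2 * r \<Longrightarrow> map X [i..<i + n] = take n (drop j (f (X m) @ f (X (Suc m))))"
    using fixed_point_factor[OF assms(1), of i] by metis
  have "i mod r = j" "i div r = m" using i by auto
  moreover have "map X [i..<i + n] = take n (drop j (f (X m) @ f (X (Suc m))))"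
    using i(2) assms(2) by (intro fac) simp
  moreover have "(j, X m, take n (drop j (f (X m) @ f (X (Suc m))))) \<in> set (factor_table f r n)"
    unfolding factor_table_def
  proof (intro concat_mapI)
    show "X m \<in> set [False, True]" "X (Suc m) \<in> set [False, True]" by simp_all
    show "(j, X m, take n (drop j (f (X m) @ f (X (Suc m))))) \<in>
        set (map (\<lambda>i. (i, X m, take n (drop i (f (X m) @ f (X (Suc m)))))) [0..<r])"
      unfolding set_map by (rule image_eqI[of _ _ j]) (use i(2) in simp_all)
  qed
  ultimately show ?thesis by simp
qed

definition factor_list :: "(bool \<Rightarrow> bool list) \<Rightarrow> nat \<Rightarrow> nat \<Rightarrow> bool list list" where
  "factor_list f r n = remdups (map (\<lambda>(i, a, x). x) (factor_table f r n))"

lemma factor_listI: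
  "fixed_point f r X \<Longrightarrow> n \<le> Suc r \<Longrightarrow> map X [i..<i + n] \<in> set (factor_list f r n)"
  unfolding factor_list_def set_remdups set_map by (rule image_eqI[OF _ factor_tableI]) auto

definition cube_free :: "(bool \<Rightarrow> bool list) \<Rightarrow> nat \<Rightarrow> bool" where
  "cube_free f r = list_all (\<lambda>(i, a, x). \<not> eql x [a, a, a] \<and> \<not> eql x [\<not> a, \<not> a, \<not> a]) (factor_table f r 3)"

lemma cube_freeD:
  assumes "cube_free f r" "fixed_point f r X" "2 \<le> r"
  shows "\<not> (X q = X (Suc q) \<and> X (Suc q) = X (Suc (Suc q)))"
proof -
  have "map X [q..<q + 3] \<noteq> [b, b, b]" for b
    using factor_tableI[OF assms(2), of 3 q] assms(1,3)
    unfolding cube_free_def list_all_iff by (cases "b = X (q div r)") (auto simp: eql_iff)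
  moreover have "map X [q..<q + 3] = [X q, X (Suc q), X (Suc (Suc q))]"
    by (simp add: upt_rec numeral_3_eq_3)
  ultimately have "[X q, X (Suc q), X (Suc (Suc q))] \<noteq> [X q, X q, X q]" by metis
  then show ?thesis by auto
qed

definition synchronizing :: "(bool \<Rightarrow> bool list) \<Rightarrow> nat \<Rightarrow> nat \<Rightarrow> bool" where
  "synchronizing f r n = list_all (\<lambda>(i, a, x). list_all (\<lambda>(j, b, y). eql x y \<longrightarrow> i = j \<and> a = b)
     (factor_table f r n)) (factor_table f r n)"

lemma synchronizingD:
  assumes "synchronizing f r n" "fixed_point f r X" "n \<le> Suc r"
    and "\<And>l. l < n \<Longrightarrow> X (i + l) = X (j + l)"
  shows "i mod r = j mod r \<and> X (i div r) = X (j div r)"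
proof -
  have "map X [i..<i + n] = map X [j..<j + n]" using assms(4) by (auto intro!: nth_equalityI)
  then show ?thesis
    using factor_tableI[OF assms(2,3), of i] factor_tableI[OF assms(2,3), of j] assms(1)
    unfolding synchronizing_def list_all_iff by (fastforce simp: eql_iff)
qed

text \<open>Three images reach lengths up to \<open>2 * r + 1\<close>, where
  \<open>factor_table\<close> stops at \<open>r + 1\<close>. The six triples are those left when
  cubes of letters are excluded.\<close>

definition triple_table :: "(bool \<Rightarrow> bool list) \<Rightarrow> nat \<Rightarrow> nat \<Rightarrow> bool list list" where
  "triple_table h r n = concat (map (\<lambda>u. map (\<lambda>i. take n (drop i (concat (map h u)))) [0..<r])
     [[False, False, True], [False, True, False], [False, True, True],
      [True, False, False], [True, False, True], [True, True, False]])"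

lemma triple_tableI:
  assumes h: "fixed_point h r X" and n: "n \<le> Suc (2 * r)"
    and cube: "\<And>q. \<not> (X q = X (Suc q) \<and> X (Suc q) = X (Suc (Suc q)))"
  shows "map X [i..<i + n] \<in> set (triple_table h r n)"
proof -
  have r: "0 < r" "\<And>b. length (h b) = r" using h by (auto simp: fixed_point_def)
  define u where "u = map X [i div r..<i div r + 3]"
  have "u = [X (i div r), X (Suc (i div r)), X (Suc (Suc (i div r)))]"
    by (simp add: u_def upt_rec numeral_3_eq_3)
  then have u: "u \<in> set [[False, False, True], [False, True, False], [False, True, True],
      [True, False, False], [True, False, True], [True, True, False]]"
    using cube[of "i div r"] by auto
  have len: "length (concat (map h u)) = 3 * r"
    using length_concat_uniform[of h r u] r by (simp add: u_def)
  have ir: "i mod r < r" using r by simp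
  have "map X [i..<i + n] = take n (drop (i mod r) (concat (map h u)))"
  proof (rule nth_equalityI)
    show "length (map X [i..<i + n]) = length (take n (drop (i mod r) (concat (map h u))))"
      using len n ir by simp
    fix l assume "l < length (map X [i..<i + n])"
    then have l: "l < n" by simp
    have "concat (map h u) ! (i mod r + l) = X (r * (i div r) + (i mod r + l))"
      unfolding u_def using l n ir by (intro fixed_point_window[OF h]) simp
    then show "map X [i..<i + n] ! l = take n (drop (i mod r) (concat (map h u))) ! l"
      using l n ir len by (simp add: add.assoc[symmetric])
  qed
  moreover have "i mod r \<in> set [0..<r]" using ir by simp
  ultimately have "map X [i..<i + n] \<in> set (map (\<lambda>i. take n (drop i (concat (map h u)))) [0..<r])"
    unfolding set_map by (rule image_eqI)
  then show ?thesis unfolding triple_table_def by (rule concat_mapI[OF u])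
qed

definition reversal_free :: "(bool \<Rightarrow> bool list) \<Rightarrow> nat \<Rightarrow> nat \<Rightarrow> bool" where
  "reversal_free h r n = list_all (\<lambda>x. list_all (\<lambda>y. \<not> eql x y) (map rev (triple_table h r n)))
     (triple_table h r n)"

lemma reversal_freeD:
  assumes "reversal_free h r n" and h: "fixed_point h r X" and n: "n \<le> Suc (2 * r)"
    and cube: "\<And>q. \<not> (X q = X (Suc q) \<and> X (Suc q) = X (Suc (Suc q)))"
    and e: "n \<le> e" and rev: "\<And>l. l < n \<Longrightarrow> X (e - Suc l) = X (b + l)"
  shows False
proof -
  have "map X [b..<b + n] = rev (map X [e - n..<e - n + n])"
    using rev e by (auto intro!: nth_equalityI simp: rev_nth)
  then show False
    using triple_tableI[OF h n cube, of b] triple_tableI[OF h n cube, of "e - n"] assms(1)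
    unfolding reversal_free_def list_all_iff eql_iff set_map by blast
qed

definition permute :: "nat list \<Rightarrow> 'a list \<Rightarrow> 'a list" where
  "permute sg l = map (nth l) sg"

text \<open>
  If \<open>f\<close> acts on rankings like the single letters do, up to conjugation by a permutation of the
  positions, then the states at the block boundaries of \<open>f\<close> are a relabelled copy of the sequence
  of all states.
\<close>

lemma (in coded_word) kernel_descent:
  assumes f: "fixed_point f r X" and c: "length c = k" "distinct c"
    and sg: "distinct sg" "set sg = {..<k}"
    and conj: "\<And>b. steps (f b) (permute sg c) = permute sg (step b c)"
    and eq: "s (r * i) = s (r * j)"
  shows "s i = s j"
proof -
  have lsg: "length sg = k" using sg distinct_card[of sg] by simp
  have pm: "permute sg (map \<pi> l) = map \<pi> (permute sg l)" if "length l = k" for \<pi> :: "'b \<Rightarrow> 'c" and l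
    using that sg by (auto simp: permute_def)
  \<comment> \<open>Every ranking is a renaming of \<open>c\<close>, and \<open>steps\<close>,
    \<open>step\<close> and \<open>permute\<close> all commute with renamings.\<close>
  have conj': "steps (f b) (permute sg (s q)) = permute sg (step b (s q))" for b q
  proof -
    obtain \<pi> where "s q = map \<pi> c" using renaming[OF c, of q] by metis
    then show ?thesis using c conj[of b] by (simp add: pm map_step[symmetric] map_steps[symmetric])
  qed
  have set_p: "set (permute sg l) = set l" "length (permute sg l) = k" if "length l = k" for l :: "'a list"
    using that sg lsg nth_image[of k l] by (simp_all add: permute_def atLeast0LessThan)
  have dp: "distinct (permute sg (s 0))"
    using set_p[of "s 0"] dist_s[of 0] len_s[of 0] by (metis card_distinct distinct_card)
  \<comment> \<open>The ranking \<open>s 0\<close> and its permuted copy differ by a renaming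
    \<open>\<rho>\<close>, and the same \<open>\<rho>\<close> then works at every multiple of
    \<open>r\<close>.\<close>
  obtain \<rho> where \<rho>: "s 0 = map \<rho> (permute sg (s 0))" "inj_on \<rho> (set (permute sg (s 0)))"
    using ex_renaming[OF _ dist_s dp, of 0] set_p(2) len_s by metis
  have st: "s (r * q) = map \<rho> (permute sg (s q))" for q
  proof (induction q)
    case 0 then show ?case using \<rho>(1) by simp
  next
    case (Suc q)
    have "map X [r * q..<r * q + r] = f (X q)"
      using f by (intro nth_equalityI) (auto simp: fixed_point_def)
    then have "s (r * Suc q) = steps (f (X q)) (s (r * q))"
      using s_add[of "r * q" r] by (simp add: add.commute)
    also have "\<dots> = map \<rho> (permute sg (step (X q) (s q)))"
      by (simp add: Suc map_steps[symmetric] conj')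
    finally show ?case by (simp add: s_Suc)
  qed
  have "map \<rho> (permute sg (s i)) = map \<rho> (permute sg (s j))" using eq st by metis
  moreover have "set (permute sg (s q)) = set (permute sg (s 0))" for q
    using set_p len_s set_s by metis
  ultimately have p: "permute sg (s i) = permute sg (s j)"
    using \<rho>(2) by (metis map_inj_on Un_absorb)
  show ?thesis
  proof (rule nth_equalityI)
    show "length (s i) = length (s j)" by (simp add: len_s)
    fix n assume "n < length (s i)"
    then have "n \<in> set sg" using sg by (simp add: len_s)
    then show "s i ! n = s j ! n" using p by (simp add: permute_def)
  qed
qed

definition units :: "nat \<Rightarrow> unit list" where
  "units n = replicate n ()"

lemma length_units [simp]: "length (units n) = n"
  by (simp add: units_def)

definition all_pairs :: "(bool \<Rightarrow> bool \<Rightarrow> bool) \<Rightarrow> bool" where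
  "all_pairs Q \<longleftrightarrow> Q False False \<and> Q False True \<and> Q True False \<and> Q True True"

lemma all_pairsD: "all_pairs Q \<Longrightarrow> Q a b"
  by (cases a; cases b) (auto simp: all_pairs_def)

definition kernel_cert :: "(bool \<Rightarrow> bool list) \<Rightarrow> nat \<Rightarrow> 'a list \<Rightarrow> nat \<times> nat \<Rightarrow> bool" where
  "kernel_cert h r c = (\<lambda>(n, p). all_pairs (\<lambda>a b.
     avoid_kernel (units r) (units n) (units (p + n)) c (h a @ h b)))"

definition mirror_cert :: "(bool \<Rightarrow> bool list) \<Rightarrow> nat \<Rightarrow> 'a list \<Rightarrow> nat \<Rightarrow> bool" where
  "mirror_cert h r c d = all_pairs (\<lambda>a b. avoid_mirror (units r) (units (d + 2)) c (h a @ h b))"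

text \<open>\<open>(8 * r + 4) div 3\<close> is \<open>(8 * r + 2) / 3\<close> rounded up, the bound
  on the offset in \<open>letter_window\<close>. Distances start at 1, so \<open>p + n - 1\<close>
  further letters reach distance \<open>p\<close>.\<close>

definition repetition_cert :: "(bool \<Rightarrow> bool list) \<Rightarrow> nat \<Rightarrow> 'a list \<Rightarrow> nat \<Rightarrow> nat \<times> nat \<Rightarrow> bool" where
  "repetition_cert h r c len = (\<lambda>(n, p). list_all (\<lambda>u.
     avoid_rep (units ((8 * r + 4) div 3)) (units n) (units (p + n - 1)) (letters c (concat (map h u))))
     (factor_list h r len))"

text \<open>The range of starting positions grows by \<open>n\<close> because a search starts from
  the last letter of the left factor.\<close>

definition reversal_cert :: "(bool \<Rightarrow> bool list) \<Rightarrow> nat \<Rightarrow> 'a list \<Rightarrow> nat \<Rightarrow> nat \<times> nat \<Rightarrow> bool" where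
  "reversal_cert h r c len = (\<lambda>(n, d). list_all (\<lambda>u.
     avoid_rev (units ((8 * r + 4) div 3 + n)) (units n) (units (d + n - 1)) []
       (letters c (concat (map h u))))
     (factor_list h r len))"

section \<open>Certificates\<close>

text \<open>
  The constants \<open>al\<close>, \<open>ga\<close>, \<open>be\<close> give the bound on kernel repetitions. Repetitions \<open>xyx\<close> with
  \<open>|x| \<le> N\<close> and reversed ones with \<open>|x| \<le> k + 8\<close> are left to the finite searches, whose tables list
  pairs \<open>(n, p)\<close> such that no overlap of length \<open>n\<close> occurs at a distance up to \<open>p\<close>.
\<close>

locale certificate =
  fixes k :: nat and f h h' :: "bool \<Rightarrow> bool list" and r rh rh' S al ga be N L D len :: nat
    and c :: "'b list" and sg :: "nat list" and kers reps revs :: "(nat \<times> nat) list"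
  assumes k_ge: "4 \<le> k" and r_ge: "2 \<le> r" and S_le: "S \<le> Suc r" and L_le: "L \<le> Suc (2 * rh')"
    and len: "0 < len" "len \<le> Suc rh'"
    and f_eq: "f b = map (\<lambda>a. a = 2) (f_of k (if b then 2 else 1))"
    and len_f: "length (f b) = r"
    and h_power: "fixed_point f r X \<Longrightarrow> fixed_point h rh X"
    and h'_power: "fixed_point f r X \<Longrightarrow> fixed_point h' rh' X"
    and last_letter: "f False ! (r - 1) \<noteq> f True ! (r - 1)"
    and cube: "cube_free f r"
    and synch: "synchronizing f r S"
    and c: "length c = k" "distinct c"
    and sg: "distinct sg" "set sg = {..<k}"
    and conj: "steps (f b) (permute sg c) = permute sg (step b c)"
    and kers: "list_all (kernel_cert h rh c) kers" "(n, p) \<in> set kers \<Longrightarrow> p + n \<le> rh"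
    and kers_cover: "Q < S \<Longrightarrow> al * P < ga * (Q + 1) + be \<Longrightarrow> \<exists>(n, p) \<in> set kers. n \<le> Q \<and> P \<le> p"
    and reps: "list_all (repetition_cert h' rh' c len) reps"
      "(n, p) \<in> set reps \<Longrightarrow> 0 < n \<and> 3 * (p + n) + 5 \<le> 7 * (rh' * (len - 1))"
    and reps_cover: "0 < n \<Longrightarrow> n \<le> N \<Longrightarrow> p < (k - 2) * n \<Longrightarrow> \<exists>(n', p') \<in> set reps. n' \<le> n \<and> p \<le> p'"
    and far: "N < n \<Longrightarrow> k + 2 \<le> n"
      "\<lbrakk>N < n; ga * (Q + 1) + be \<le> al * P; 7 * P \<le> 3 * p + 2; 3 * n \<le> 8 * Q + 12 + 3 * k\<rbrakk> \<Longrightarrow>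
        (k - 2) * n \<le> p"
    and revs: "list_all (reversal_cert h' rh' c len) revs"
      "(n, d) \<in> set revs \<Longrightarrow> 0 < n \<and> 3 * (d + n) + 3 * n + 5 \<le> 7 * (rh' * (len - 1))"
    and revs_cover: "0 < n \<Longrightarrow> n \<le> k + 8 \<Longrightarrow> d \<le> (k - 3) * n \<Longrightarrow> \<exists>(n', d') \<in> set revs. n' \<le> n \<and> d \<le> d'"
    and mirror_chk: "mirror_cert h rh c D" "D + 4 \<le> rh"
    and rev_free: "reversal_free h' rh' L"
    and D_bound: "3 * n \<le> 8 * L + 7 + 3 * k \<Longrightarrow> 7 * d \<le> 3 * ((k - 3) * n + k + 4) + 2 \<Longrightarrow> d \<le> D"

locale certified_word = coded_word k X s T w +
  certificate k f h h' r rh rh' S al ga be N L D len c sg kers reps revs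
  for k X and s :: "nat \<Rightarrow> 'a list" and T w f h h' r rh rh' S al ga be N L D len
    and c :: "'b list" and sg kers reps revs +
  assumes f: "fixed_point f r X"
begin

lemma h: "fixed_point h rh X" and h': "fixed_point h' rh' X"
  using f by (rule h_power, rule h'_power)

sublocale coded_morphic_word k X s T w f r S al ga be
proof
  show "2 \<le> r" by (rule r_ge)
  show "j < r \<Longrightarrow> X (r * m + j) = f (X m) ! j" for j m using f by (simp add: fixed_point_def)
  show "f False ! (r - 1) \<noteq> f True ! (r - 1)" by (rule last_letter)
  show "(\<And>l. l < S \<Longrightarrow> X (i + l) = X (j + l)) \<Longrightarrow> i mod r = j mod r \<and> X (i div r) = X (j div r)" for i j
    by (rule synchronizingD[OF synch f S_le])
  show "s (r * i) = s (r * j) \<Longrightarrow> s i = s j" for i j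
    by (rule kernel_descent[OF f c sg conj])
  fix P i Q assume *: "0 < P" "s i = s (i + P)" "\<And>l. l < Q \<Longrightarrow> X (i + l) = X (i + P + l)" "Q < S"
  show "ga * (Q + 1) + be \<le> al * P"
  proof (rule ccontr)
    assume "\<not> ga * (Q + 1) + be \<le> al * P"
    then obtain n p where np: "(n, p) \<in> set kers" "n \<le> Q" "P \<le> p"
      using kers_cover[OF *(4), of P] by auto
    have chk: "avoid_kernel (units rh) (units n) (units (p + n)) c (h a @ h b)" for a b
      using kers(1) np(1) all_pairsD[of _ a b] unfolding kernel_cert_def list_all_iff by fastforce
    show False
    proof (rule kernel_avoided[OF h c chk, of P i])
      show "X (i + l) = X (i + P + l)" if "l < length (units n)" for l
        using *(3) that np(2) by simp
      show "s i = s (i + P)" by (rule *(2))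
    qed (use *(1) np(3) kers(2)[OF np(1)] in simp_all)
  qed
qed

text \<open>Up to length \<open>N\<close> the tables decide. Beyond it a long overlap forces a large
  \<open>Q\<close>, hence a large \<open>P\<close> by the kernel bound, hence a distance of at least
  \<open>(k - 2) * n\<close>.\<close>

lemma no_repetition:
  assumes n: "0 < n" and p: "0 < p" "p < (k - 2) * n"
    and rep: "\<And>l. l < n \<Longrightarrow> w (i + l) = w (i + p + l)"
  shows False
proof (cases "n \<le> N")
  case True
  then obtain n' p' where np: "(n', p') \<in> set reps" "n' \<le> n" "p \<le> p'"
    using reps_cover n p by blast
  have chk: "avoid_rep (units ((8 * rh' + 4) div 3)) (units n') (units (p' + n' - 1))
      (letters c (concat (map h' (map X [m..<m + len]))))" for m
    using reps(1) np(1) factor_listI[OF h' len(2), of m]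
    unfolding repetition_cert_def list_all_iff by fastforce
  show False
    by (rule repetition_avoided[OF h' c len(1) chk, of p i]) (use reps(2)[OF np(1)] np p rep in auto)
next
  case False
  then have N: "N < n" by simp
  from repetition_bound[OF far(1)[OF N] p(1) rep]
  obtain P Q where "ga * (Q + 1) + be \<le> al * P" "7 * P \<le> 3 * p + 2" "3 * n \<le> 8 * Q + 12 + 3 * k"
    by blast
  then show False using far(2)[OF N, of Q P p] p by simp
qed

lemma no_reversal:
  assumes n: "0 < n" and ij: "i + n \<le> j" "j - i < (k - 2) * n"
    and rev: "\<And>l. l < n \<Longrightarrow> w (i + l) = w (j + n - 1 - l)"
  shows False
proof -
  have k2: "(k - 2) * n = (k - 3) * n + n"
  proof -
    have "k - 2 = Suc (k - 3)" using k4 by simp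
    then show ?thesis by simp
  qed
  show False
  proof (cases "n \<le> k + 8")
    case True
    \<comment> \<open>The distance from the last letter of the left factor to the first of the right
      one; \<open>j - i < (k - 2) * n\<close> becomes \<open>d \<le> (k - 3) * n\<close>.\<close>
    define d where "d = j - (i + n - 1)"
    have d: "0 < d" "d \<le> (k - 3) * n" "i + n - 1 + d = j" using n ij k2 by (auto simp: d_def)
    obtain n' d' where nd: "(n', d') \<in> set revs" "n' \<le> n" "d \<le> d'"
      using revs_cover n True d(2) by blast
    note rv = revs(2)[OF nd(1)]
    have chk: "avoid_rev (units ((8 * rh' + 4) div 3 + n')) (units n') (units (d' + n' - 1)) []
        (letters c (concat (map h' (map X [m..<m + len]))))" for m
      using revs(1) nd(1) factor_listI[OF h' len(2), of m]
      unfolding reversal_cert_def list_all_iff by fastforce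
    \<comment> \<open>Only the inner \<open>n'\<close> letters on each side are kept, which leaves
      \<open>d\<close> unchanged.\<close>
    have "w (i + (n - n') + l) = w (i + (n - n') + n' - 1 + d + (n' - 1 - l))" if "l < n'" for l
    proof -
      have "i + (n - n') + n' - 1 + d + (n' - 1 - l) = j + n - 1 - (n - n' + l)"
        using d(3) nd(2) that n by linarith
      then show ?thesis using rev[of "n - n' + l"] that nd(2) by (simp add: add.assoc)
    qed
    then show False
      by (intro reversal_avoided[OF h' c len(1) chk, of d "i + (n - n')"]) (use rv nd d in auto)
  next
    case False
    then have n9: "k + 9 \<le> n" by simp
    obtain e B l where *: "l \<le> e" "e < B" "T B + k + n \<le> T e + (j - i) + 2 * k + 5"
      "\<And>m. m \<le> l \<Longrightarrow> mirrored (s (e - m)) (s (B + m))"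
      "\<And>m. m < l \<Longrightarrow> X (e - Suc m) = X (B + m)" "3 * n \<le> 8 * l + 15 + 3 * k"
      using reversal_mirrored[OF n9 ij(1) rev] by metis
    \<comment> \<open>Otherwise \<open>X\<close> would have a factor of length \<open>L\<close>
      whose reversal is also a factor. With \<open>l \<le> L - 1\<close> the constant 15 becomes the
      7 of \<open>D_bound\<close>.\<close>
    have "l < L"
    proof (rule ccontr)
      assume "\<not> l < L"
      then show False
        using *(1,5) by (intro reversal_freeD[OF rev_free h' L_le no_cube, of e B]) auto
    qed
    have "7 * (B - e) \<le> 3 * (T B - T e) + 2" using T_bounds[of "B - e" e] *(2) by simp
    moreover have "T B - T e \<le> (k - 3) * n + k + 4" using *(3) ij k2 by linarith
    ultimately have "7 * (B - e) \<le> 3 * ((k - 3) * n + k + 4) + 2"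
      by (meson add_le_mono1 mult_le_mono2 order_trans)
    then have D: "B - e \<le> D" using \<open>l < L\<close> *(6) by (intro D_bound[of n]) auto
    \<comment> \<open>Two matched blocks provide the three mirrored pairs that
      \<open>mirror_avoided\<close> uses.\<close>
    have l2: "2 \<le> l" using *(6) n9 by simp
    have chk: "avoid_mirror (units rh) (units (D + 2)) c (h a @ h b)" for a b
      using mirror_chk(1) all_pairsD unfolding mirror_cert_def by blast
    have "mirrored (s (e - 2 + 2 - m)) (s (e - 2 + 2 + (B - e) + m))" if "m \<le> 2" for m
    proof -
      have "e - 2 + 2 = e" "e + (B - e) = B" using l2 *(1,2) by simp_all
      then show ?thesis using *(4)[of m] that l2 by simp
    qed
    then show False
      by (intro mirror_avoided[OF h c chk, of "B - e" "e - 2"]) (use mirror_chk D *(2) in auto)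
  qed
qed

end

text \<open>With \<open>n = |x|\<close> and \<open>p = |xy|\<close> the exponent is
  \<open>(p + n) / p\<close>, which exceeds \<open>(k - 1) / (k - 2)\<close> exactly when
  \<open>p < (k - 2) * n\<close>. Since \<open>n \<le> p\<close>, the factors \<open>x\<close> and
  \<open>x'\<close> do not overlap.\<close>

lemma undirected_plus_freeI:
  assumes k: "4 \<le> k"
    and rep: "\<And>n p i. 0 < n \<Longrightarrow> 0 < p \<Longrightarrow> p < (k - 2) * n \<Longrightarrow>
      (\<And>l. l < n \<Longrightarrow> w !! (i + l) = w !! (i + p + l)) \<Longrightarrow> False"
    and rev: "\<And>n i j. 0 < n \<Longrightarrow> i + n \<le> j \<Longrightarrow> j - i < (k - 2) * n \<Longrightarrow>
      (\<And>l. l < n \<Longrightarrow> w !! (i + l) = w !! (j + n - 1 - l)) \<Longrightarrow> False"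
  shows "undirected_plus_free (of_nat (k - 1) / of_nat (k - 2)) w"
  unfolding undirected_plus_free_def
proof
  assume "\<exists>z\<in>factors w. \<exists>r>of_nat (k - 1) / of_nat (k - 2). undirected_power r z"
  then obtain m i r x y x' where z: "stake m (sdrop i w) = x @ y @ x'"
    and r: "of_nat (k - 1) / of_nat (k - 2) < (r :: rat)"
    and x: "x \<noteq> []" "x' \<in> {x, rev x}"
    and len: "of_nat (length (x @ y @ x')) / of_nat (length (x @ y)) = r"
    unfolding factors_def undirected_power_def by auto
  define n where "n = length x"
  define p where "p = length (x @ y)"
  have n: "0 < n" "n \<le> p" "length x' = n" using x by (auto simp: n_def p_def)
  have "of_nat (k - 1) / of_nat (k - 2) < (of_nat (p + n) / of_nat p :: rat)"
    using r len n(3) by (simp add: p_def add.assoc)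
  then have "of_nat ((k - 1) * p) < (of_nat ((p + n) * (k - 2)) :: rat)"
    using n k by (simp add: divide_simps mult.commute split: if_splits)
  then have "(k - 1) * p < (p + n) * (k - 2)" by (simp only: of_nat_less_iff)
  moreover have "k - 1 = Suc (k - 2)" using k by simp
  ultimately have p: "p < (k - 2) * n" by (simp add: algebra_simps)
  have w: "w !! (i + l) = (x @ y @ x') ! l" if "l < p + n" for l
  proof -
    have "m = p + n" using z n(3) by (metis length_append length_stake add.assoc p_def)
    then show ?thesis using that z stake_nth[of l m "sdrop i w"] by (simp add: sdrop_snth add.commute)
  qed
  have w1: "w !! (i + l) = x ! l" if "l < n" for l
    using w[of l] that by (simp add: n_def nth_append)
  have w2: "w !! (i + p + l) = x' ! l" if "l < n" for l
    using w[of "p + l"] that unfolding append_assoc[symmetric]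
    by (simp only: nth_append p_def[symmetric]) (simp add: add.assoc)
  from x(2) show False
  proof
    assume "x' = x"
    then show False using rep[of n p i] n p w1 w2 by simp
  next
    assume "x' \<in> {rev x}"
    then have "w !! (i + l) = w !! (i + p + n - 1 - l)" if "l < n" for l
      using w1[OF that] w2[of "n - 1 - l"] that n
      by (simp add: n_def rev_nth)
    then show False using rev[of n i "i + p"] n p by simp
  qed
qed

text \<open>Position \<open>r * m + j\<close> is read off in \<open>F (Suc n)\<close>, the image of
  \<open>F n\<close>, for any \<open>n\<close> with \<open>m < r ^ n\<close>.\<close>

lemma omega_word_fixed_point:
  assumes f: "\<And>b. f b = map (\<lambda>a. a = 2) (f_of k (if b then 2 else 1))"
    and r: "0 < r" "length (f_of k 1) = r" "length (f_of k 2) = r" and r1: "1 < r"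
  shows "fixed_point f r (\<lambda>q. omega_word (f_of k) 1 !! q = 2)"
proof -
  define x where "x = omega_word (f_of k) 1"
  define F where "F n = (morph (f_of k) ^^ n) [1]" for n
  have pre: "stake (length (F n)) x = F n" for n
    using omega_word_f(1)[of k] by (simp add: F_def x_def)
  have x12: "x !! q \<in> {1, 2}" for q
    using omega_word_f(2)[of k] snth_sset unfolding x_def by blast
  define h where "h b = f_of k (if b then 2 else 1)" for b
  have hl: "length (h b) = r" for b using r by (simp add: h_def)
  have F12: "set (F n) \<subseteq> {1, 2}" for n
    using x12 pre[of n] by (metis (no_types, lifting) in_set_conv_nth length_stake stake_nth subsetI)
  have FS: "F (Suc n) = concat (map h (map (\<lambda>a. a = 2) (F n)))" for n
  proof -
    have "map h (map (\<lambda>a. a = 2) (F n)) = map (f_of k) (F n)"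
      using F12[of n] by (auto simp: h_def)
    moreover have "F (Suc n) = concat (map (f_of k) (F n))" by (simp add: F_def morph_def)
    ultimately show ?thesis by (simp only:)
  qed
  have len: "length (F n) = r ^ n" for n
  proof (induction n)
    case 0 show ?case by (simp add: F_def)
  next
    case (Suc n)
    then show ?case unfolding FS length_concat_uniform[of h r, OF hl] by simp
  qed
  have big: "\<exists>n. m < r ^ n" for m
    using r1 power_gt_expt[of r m] by auto
  have "x !! (r * m + j) = h (x !! m = 2) ! j" if "j < r" for m j
  proof -
    obtain n where n: "m < r ^ n" using big by blast
    have "r * m + j < r * r ^ n" using n that
      by (metis Suc_leI add.commute add_less_cancel_right add_less_mono less_le_trans mult_Suc_right mult_le_mono2 nat_add_left_cancel_less)
    then have "x !! (r * m + j) = F (Suc n) ! (r * m + j)"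
      using pre[of "Suc n"] by (metis len power_Suc stake_nth)
    also have "\<dots> = h (F n ! m = 2) ! j"
      unfolding FS using hl r that n \<open>r * m + j < r * r ^ n\<close>
      by (subst nth_concat_uniform[where r = r]) (simp_all add: len)
    also have "F n ! m = x !! m" using pre[of n] n by (metis len stake_nth)
    finally show ?thesis .
  qed
  then show ?thesis
    using r hl unfolding fixed_point_def f x_def[symmetric] h_def[symmetric] by simp
qed

lemma coded_word_of_encoding:
  assumes k: "4 \<le> k" and wk: "sset w \<subseteq> {1..k}" and pre: "stake (k - 1) w = [1..<k]"
    and enc: "encodable k w" and t: "encoding k w = smorph g x" and x: "sset x \<subseteq> {1, 2}"
    and cube: "\<And>q. \<not> (X q = X (Suc q) \<and> X (Suc q) = X (Suc (Suc q)))"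
    and X: "X = (\<lambda>q. x !! q = 2)"
  shows "coded_word k X (state X (k # [1..<k])) (start X) (snth w)"
proof
  have st: "length (state X (k # [1..<k]) q) = k" "distinct (state X (k # [1..<k]) q)"
    "set (state X (k # [1..<k]) q) = set (k # [1..<k])" for q
    using k by (induction q) auto
  then show "length (state X (k # [1..<k]) q) = k" "distinct (state X (k # [1..<k]) q)"
    "set (state X (k # [1..<k]) q) = set (state X (k # [1..<k]) 0)" for q by auto
  show "w !! (start X q + l) = state X (k # [1..<k]) q ! Suc l" if "l < k - 1" for l q
  proof -
    have "stake (k - 1) (sdrop (start X q) w) = tl (state X (k # [1..<k]) q)"
      unfolding X by (rule encoded_state(2)[OF k wk pre enc t x])
    then have "sdrop (start X q) w !! l = tl (state X (k # [1..<k]) q) ! l"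
      using that by (metis stake_nth)
    then show ?thesis using st(1)[of q] that by (simp add: sdrop_snth nth_tl)
  qed
qed (use k cube in \<open>auto simp: start_def\<close>)

context certificate
begin

theorem encoded_word_free:
  assumes "sset w \<subseteq> {1..k}" "stake (k - 1) w = [1..<k]" "encodable k w"
    and "encoding k w = smorph g (omega_word (f_of k) 1)"
  shows "undirected_plus_free (of_nat (k - 1) / of_nat (k - 2)) w"
proof -
  define X where "X = (\<lambda>q. omega_word (f_of k) 1 !! q = 2)"
  have "length (f_of k 1) = r" "length (f_of k 2) = r"
    using len_f[of False] len_f[of True] by (simp_all add: f_eq)
  then have f: "fixed_point f r X"
    unfolding X_def using r_ge by (intro omega_word_fixed_point f_eq) auto
  interpret coded_word k X "state X (k # [1..<k])" "start X" "snth w"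
    by (rule coded_word_of_encoding[OF k_ge assms omega_word_f(2) cube_freeD[OF cube f r_ge] X_def])
  interpret certified_word k X "state X (k # [1..<k])" "start X" "snth w"
    by unfold_locales (rule f)
  show ?thesis
    using k_ge no_repetition no_reversal by (rule undirected_plus_freeI)
qed

end

definition square :: "(bool \<Rightarrow> bool list) \<Rightarrow> bool \<Rightarrow> bool list" where
  "square f b = concat (map f (f b))"

lemma fixed_point_square: "fixed_point f r X \<Longrightarrow> fixed_point (square f) (r * r) X"
  using fixed_point_comp[of f r X f r] by (simp add: square_def[abs_def])

text \<open>The morphisms \<open>f4\<close>, \<open>f8\<close>, \<open>f12\<close> with the letters \<open>1\<close>, \<open>2\<close> written as \<open>False\<close>, \<open>True\<close>.\<close>

fun bf4 :: "bool \<Rightarrow> bool list" where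
  "bf4 False = [False, True, False]"
| "bf4 True = [False, True, True]"

fun bf8 :: "bool \<Rightarrow> bool list" where
  "bf8 False = [False, True, False, True, False, True, False, False, True, False, True, True,
     False, True, False]"
| "bf8 True = [True, False, False, True, False, True, False, True, True, False, True, True,
     False, False, True]"

fun bf12 :: "bool \<Rightarrow> bool list" where
  "bf12 False = [False, True, False, True, False, True, False, True, False, True, False, False,
     True, False, True, False, True, True, False, True, False]"
| "bf12 True = [True, False, True, False, True, True, False, False, True, False, True, False,
     False, True, False, True, False, True, True, False, True]"

definition c4 :: "letter list" where
  "c4 = [L0, L1, L2, L3]"

definition c8 :: "letter list" where
  "c8 = [L0, L1, L2, L3, L4, L5, L6, L7]"

definition c12 :: "letter list" where
  "c12 = [L0, L1, L2, L3, L4, L5, L6, L7, L8, L9, L10, L11]"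

section \<open>The three morphisms\<close>

lemma bf4_kernels: "list_all (kernel_cert (square (square bf4)) 81 c4) [(0, 3), (1, 6), (2, 9)]"
  by code_simp

lemma bf4_mirrors: "mirror_cert (square (square bf4)) 81 c4 15"
  by code_simp

text \<open>An entry \<open>(n, p)\<close> also excludes longer overlaps at distances up to
  \<open>p\<close>, so one entry can serve a range of lengths.\<close>

lemma bf4_repetitions: "list_all (repetition_cert (square bf4) 9 c4 4)
    [(1, 1), (2, 5), (4, 9), (6, 19), (9, 24), (11, 31)]"
  by code_simp

lemma bf4_reversals: "list_all (reversal_cert (square bf4) 9 c4 4)
    [(1, 1), (2, 3), (4, 12)]"
  by code_simp

lemma bf4_reversal_free: "reversal_free (square bf4) 9 8"
  by code_simp

lemma bf4_synchronizing: "synchronizing bf4 3 3"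
  by code_simp

text \<open>The kernel table has, for each \<open>Q < 3\<close>, the largest \<open>P\<close> with
  \<open>3 * P < 10 * (Q + 1)\<close>. Overlap length turns into distance at the rate
  \<open>7 * ga / (8 * al) = 70 / 24\<close>, above \<open>k - 2 = 2\<close>, so
  \<open>be = 0\<close> will do. The mirror search spans \<open>D + 4 = 19\<close> blocks, too many
  for images of length 9, hence the fourth power.\<close>

lemma certificate4: "certificate 4 bf4 (square (square bf4)) (square bf4) 3 81 9 3 3 10 0 16 8 15 4 c4
  [0, 3, 1, 2]
  [(0, 3), (1, 6), (2, 9)]
  [(1, 1), (2, 5), (4, 9), (6, 19), (9, 24), (11, 31)]
  [(1, 1), (2, 3), (4, 12)]"
proof (rule certificate.intro)
  show "bf4 b = map (\<lambda>a. a = 2) (f_of 4 (if b then 2 else 1))" for b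
    by (cases b) (simp_all add: f_of_def f4_def)
  show "length (bf4 b) = 3" for b by (cases b) simp_all
  show "fixed_point (square (square bf4)) 81 X" if "fixed_point bf4 3 X" for X
    using that using fixed_point_square[OF fixed_point_square, of bf4 3 X] by simp
  show "fixed_point (square bf4) 9 X" if "fixed_point bf4 3 X" for X
    using that using fixed_point_square[of bf4 3 X] by simp
  show "cube_free bf4 3" by code_simp
  show "distinct c4" by code_simp
  show "set ([0, 3, 1, 2] :: nat list) = {..<4}" by (simp add: lessThan_nat_numeral lessThan_Suc insert_commute)
  show "steps (bf4 b) (permute [0, 3, 1, 2] c4) =
      permute [0, 3, 1, 2] (step b c4)" for b
    by (cases b; simp; code_simp)
  show "\<exists>(n, p)\<in>set [(0, 3), (1, 6), (2, 9)]. n \<le> Q \<and> P \<le> p"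
    if "Q < 3" "3 * P < 10 * (Q + 1) + 0" for P Q :: nat
    using that by simp presburger
  show "\<exists>(n', p')\<in>set [(1, 1), (2, 5), (4, 9), (6, 19), (9, 24), (11, 31)].
      n' \<le> n \<and> p \<le> p'" if "0 < n" "n \<le> 16" "p < (4 - 2) * n" for n p :: nat
    using that by simp presburger
  show "(4 - 2) * n \<le> p" if "16 < n" "10 * (Q + 1) + 0 \<le> 3 * P" "7 * P \<le> 3 * p + 2"
    "3 * n \<le> 8 * Q + 12 + 3 * 4" for n p P Q :: nat
    using that by simp
  show "\<exists>(n', d')\<in>set [(1, 1), (2, 3), (4, 12)].
      n' \<le> n \<and> d \<le> d'" if "0 < n" "n \<le> 4 + 8" "d \<le> (4 - 3) * n" for n d :: nat
    using that by simp presburger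
  \<comment> \<open>The first inequality gives \<open>n \<le> 27\<close>, and then
    \<open>7 * d \<le> 107\<close>.\<close>
  show "d \<le> 15" if "3 * n \<le> 8 * 8 + 7 + 3 * 4" "7 * d \<le> 3 * ((4 - 3) * n + 4 + 4) + 2"
    for n d :: nat
    using that by simp
  show "p + n \<le> 81" if "(n, p) \<in> set [(0, 3), (1, 6), (2, 9)]" for n p :: nat
    using that by auto
  show "0 < n \<and> 3 * (p + n) + 5 \<le> 7 * (9 * (4 - 1))"
    if "(n, p) \<in> set [(1, 1), (2, 5), (4, 9), (6, 19), (9, 24), (11, 31)]" for n p :: nat
    using that by auto
  show "0 < n \<and> 3 * (d + n) + 3 * n + 5 \<le> 7 * (9 * (4 - 1))"
    if "(n, d) \<in> set [(1, 1), (2, 3), (4, 12)]" for n d :: nat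
    using that by auto
qed (fact bf4_kernels bf4_mirrors bf4_repetitions bf4_reversals bf4_reversal_free
  bf4_synchronizing | simp add: c4_def)+

lemma bf8_kernels: "list_all (kernel_cert (square bf8) 225 c8) [(0, 99)]"
  by code_simp

lemma bf8_mirrors: "mirror_cert (square bf8) 225 c8 164"
  by code_simp

lemma bf8_repetitions: "list_all (repetition_cert bf8 15 c8 4)
    [(1, 5), (2, 12), (3, 26), (5, 39), (6, 53)]"
  by code_simp

lemma bf8_reversals: "list_all (reversal_cert bf8 15 c8 4)
    [(1, 5), (2, 10), (3, 21), (5, 25), (6, 80)]"
  by code_simp

lemma bf8_reversal_free: "reversal_free bf8 15 24"
  by code_simp

lemma bf8_synchronizing: "synchronizing bf8 15 11"
  by code_simp

text \<open>Here the rate \<open>7 * 48 / (8 * 7)\<close> equals \<open>k - 2 = 6\<close> exactly,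
  so the offset \<open>be\<close> has to absorb all additive losses. No ranking recurs within 99
  blocks, and 99 is the largest \<open>P\<close> with \<open>7 * P < 48 * 11 + 170\<close>; thus one
  kernel entry with \<open>n = 0\<close> is enough.\<close>

lemma certificate8: "certificate 8 bf8 (square bf8) bf8 15 225 15 11 7 48 170 9 24 164 4 c8
  [2, 7, 4, 5, 3, 6, 0, 1]
  [(0, 99)]
  [(1, 5), (2, 12), (3, 26), (5, 39), (6, 53)]
  [(1, 5), (2, 10), (3, 21), (5, 25), (6, 80)]"
proof (rule certificate.intro)
  show "bf8 b = map (\<lambda>a. a = 2) (f_of 8 (if b then 2 else 1))" for b
    by (cases b) (simp_all add: f_of_def f8_def)
  show "length (bf8 b) = 15" for b by (cases b) simp_all
  show "fixed_point (square bf8) 225 X" if "fixed_point bf8 15 X" for X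
    using that using fixed_point_square[of bf8 15 X] by simp
  show "fixed_point bf8 15 X" if "fixed_point bf8 15 X" for X
    using that .
  show "cube_free bf8 15" by code_simp
  show "distinct c8" by code_simp
  show "set ([2, 7, 4, 5, 3, 6, 0, 1] :: nat list) = {..<8}" by (simp add: lessThan_nat_numeral lessThan_Suc insert_commute)
  show "steps (bf8 b) (permute [2, 7, 4, 5, 3, 6, 0, 1] c8) =
      permute [2, 7, 4, 5, 3, 6, 0, 1] (step b c8)" for b
    by (cases b; simp; code_simp)
  show "\<exists>(n, p)\<in>set [(0, 99)]. n \<le> Q \<and> P \<le> p"
    if "Q < 11" "7 * P < 48 * (Q + 1) + 170" for P Q :: nat
    using that by simp
  show "\<exists>(n', p')\<in>set [(1, 5), (2, 12), (3, 26), (5, 39), (6, 53)].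
      n' \<le> n \<and> p \<le> p'" if "0 < n" "n \<le> 9" "p < (8 - 2) * n" for n p :: nat
    using that by simp presburger
  show "(8 - 2) * n \<le> p" if "9 < n" "48 * (Q + 1) + 170 \<le> 7 * P" "7 * P \<le> 3 * p + 2"
    "3 * n \<le> 8 * Q + 12 + 3 * 8" for n p P Q :: nat
    using that by simp
  show "\<exists>(n', d')\<in>set [(1, 5), (2, 10), (3, 21), (5, 25), (6, 80)].
      n' \<le> n \<and> d \<le> d'" if "0 < n" "n \<le> 8 + 8" "d \<le> (8 - 3) * n" for n d :: nat
    using that by simp presburger
  \<comment> \<open>Here \<open>n \<le> 74\<close>, and then
    \<open>7 * d \<le> 1148 = 7 * 164\<close>.\<close>
  show "d \<le> 164" if "3 * n \<le> 8 * 24 + 7 + 3 * 8" "7 * d \<le> 3 * ((8 - 3) * n + 8 + 4) + 2"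
    for n d :: nat
    using that by simp
  show "p + n \<le> 225" if "(n, p) \<in> set [(0, 99)]" for n p :: nat
    using that by auto
  show "0 < n \<and> 3 * (p + n) + 5 \<le> 7 * (15 * (4 - 1))"
    if "(n, p) \<in> set [(1, 5), (2, 12), (3, 26), (5, 39), (6, 53)]" for n p :: nat
    using that by auto
  show "0 < n \<and> 3 * (d + n) + 3 * n + 5 \<le> 7 * (15 * (4 - 1))"
    if "(n, d) \<in> set [(1, 5), (2, 10), (3, 21), (5, 25), (6, 80)]" for n d :: nat
    using that by auto
qed (fact bf8_kernels bf8_mirrors bf8_repetitions bf8_reversals bf8_reversal_free
  bf8_synchronizing | simp add: c8_def)+

lemma bf12_kernels: "list_all (kernel_cert (square bf12) 441 c12) [(0, 297)]"
  by code_simp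

lemma bf12_mirrors: "mirror_cert (square bf12) 441 c12 268"
  by code_simp

lemma bf12_repetitions: "list_all (repetition_cert bf12 21 c12 5)
    [(1, 9), (2, 19), (3, 29), (4, 39), (5, 49), (6, 109), (9, 129)]"
  by code_simp

lemma bf12_reversals: "list_all (reversal_cert bf12 21 c12 5)
    [(1, 9), (2, 18), (3, 36), (5, 180)]"
  by code_simp

lemma bf12_reversal_free: "reversal_free bf12 21 20"
  by code_simp

lemma bf12_synchronizing: "synchronizing bf12 21 21"
  by code_simp

text \<open>Again the rate \<open>7 * 80 / (8 * 7)\<close> is exactly \<open>k - 2 = 10\<close>, and
  297 is the largest \<open>P\<close> with \<open>7 * P < 80 * 21 + 402\<close>. Windows of five
  images are taken because the reversal entry \<open>(5, 180)\<close>, which serves all lengths from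
  5 to 20, looks 184 letters ahead.\<close>

lemma certificate12: "certificate 12 bf12 (square bf12) bf12 21 441 21 21 7 80 402 13 20 268 5 c12
  [5, 3, 9, 1, 11, 0, 7, 4, 10, 6, 8, 2]
  [(0, 297)]
  [(1, 9), (2, 19), (3, 29), (4, 39), (5, 49), (6, 109), (9, 129)]
  [(1, 9), (2, 18), (3, 36), (5, 180)]"
proof (rule certificate.intro)
  show "bf12 b = map (\<lambda>a. a = 2) (f_of 12 (if b then 2 else 1))" for b
    by (cases b) (simp_all add: f_of_def f12_def)
  show "length (bf12 b) = 21" for b by (cases b) simp_all
  show "fixed_point (square bf12) 441 X" if "fixed_point bf12 21 X" for X
    using that using fixed_point_square[of bf12 21 X] by simp
  show "fixed_point bf12 21 X" if "fixed_point bf12 21 X" for X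
    using that .
  show "cube_free bf12 21" by code_simp
  show "distinct c12" by code_simp
  show "set ([5, 3, 9, 1, 11, 0, 7, 4, 10, 6, 8, 2] :: nat list) = {..<12}" by (simp add: lessThan_nat_numeral lessThan_Suc insert_commute)
  show "steps (bf12 b) (permute [5, 3, 9, 1, 11, 0, 7, 4, 10, 6, 8, 2] c12) =
      permute [5, 3, 9, 1, 11, 0, 7, 4, 10, 6, 8, 2] (step b c12)" for b
    by (cases b; simp; code_simp)
  show "\<exists>(n, p)\<in>set [(0, 297)]. n \<le> Q \<and> P \<le> p"
    if "Q < 21" "7 * P < 80 * (Q + 1) + 402" for P Q :: nat
    using that by simp
  show "\<exists>(n', p')\<in>set [(1, 9), (2, 19), (3, 29), (4, 39), (5, 49), (6, 109), (9, 129)].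
      n' \<le> n \<and> p \<le> p'" if "0 < n" "n \<le> 13" "p < (12 - 2) * n" for n p :: nat
    using that by simp presburger
  show "(12 - 2) * n \<le> p" if "13 < n" "80 * (Q + 1) + 402 \<le> 7 * P" "7 * P \<le> 3 * p + 2"
    "3 * n \<le> 8 * Q + 12 + 3 * 12" for n p P Q :: nat
    using that by simp
  show "\<exists>(n', d')\<in>set [(1, 9), (2, 18), (3, 36), (5, 180)].
      n' \<le> n \<and> d \<le> d'" if "0 < n" "n \<le> 12 + 8" "d \<le> (12 - 3) * n" for n d :: nat
    using that by simp presburger
  show "d \<le> 268" if "3 * n \<le> 8 * 20 + 7 + 3 * 12" "7 * d \<le> 3 * ((12 - 3) * n + 12 + 4) + 2"
    for n d :: nat
    using that by simp
  show "p + n \<le> 441" if "(n, p) \<in> set [(0, 297)]" for n p :: nat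
    using that by auto
  show "0 < n \<and> 3 * (p + n) + 5 \<le> 7 * (21 * (5 - 1))"
    if "(n, p) \<in> set [(1, 9), (2, 19), (3, 29), (4, 39), (5, 49), (6, 109), (9, 129)]" for n p :: nat
    using that by auto
  show "0 < n \<and> 3 * (d + n) + 3 * n + 5 \<le> 7 * (21 * (5 - 1))"
    if "(n, d) \<in> set [(1, 9), (2, 18), (3, 36), (5, 180)]" for n d :: nat
    using that by auto
qed (fact bf12_kernels bf12_mirrors bf12_repetitions bf12_reversals bf12_reversal_free
  bf12_synchronizing | simp add: c12_def)+

theorem theorem6:
  fixes k :: nat and w :: "nat stream"
  assumes "k \<in> {4, 8, 12}"
    and "sset w \<subseteq> {1..k}"
    and "stake (k - 1) w = [1..<k]"
    and "encodable k w"
    and "encoding k w = smorph g (omega_word (f_of k) 1)"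
  shows "undirected_plus_free (of_nat (k - 1) / of_nat (k - 2)) w"
proof -
  have "k = 4 \<or> k = 8 \<or> k = 12" using assms(1) by simp
  then show ?thesis
  proof (elim disjE)
    assume "k = 4"
    show ?thesis
      using certificate.encoded_word_free[OF certificate4] assms(2-) unfolding \<open>k = 4\<close> by blast
  next
    assume "k = 8"
    show ?thesis
      using certificate.encoded_word_free[OF certificate8] assms(2-) unfolding \<open>k = 8\<close> by blast
  next
    assume "k = 12"
    show ?thesis
      using certificate.encoded_word_free[OF certificate12] assms(2-) unfolding \<open>k = 12\<close> by blast
  qed
qed

end
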